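(* Let $\Gamma$ be a chain of cycles of genus $g \geq 3$. Then $\operatorname{Cliff}(\Gamma)=\operatorname{gon}(\Gamma)-2$.
   Context: Divisors on a metric graph $\Gamma$ are finite formal integer combinations of points of $\Gamma$; linear equivalence of divisors is the usual one from the divisor theory of metric graphs (differences of divisors of rational functions, i.e. continuous piecewise-linear functions with integer slopes). The rank $\operatorname{rank}(D)$ of a divisor $D$ is the largest integer $n$ such that for every effective divisor $E$ of degree $n$ on $\Gamma$ there is an effective divisor $D'$ linearly equivalent to $D$ with $D'-E$ effective; if $D$ is not equivalent to an effective divisor, $\operatorname{rank}(D)=-1$. The gonality $\operatorname{gon}(\Gamma)$ is the smallest integer $m$ such that there is a divisor of degree $m$ and rank at least $1$ on $\Gamma$. The Clifford index of a divisor $D$ of degree $d$ is $\operatorname{Cliff}(D)=d-2\operatorname{rank}(D)$, and the Clifford index $\operatorname{Cliff}(\Gamma)$ of a metric graph $\Gamma$ of genus $g$ is the smallest value of $\operatorname{Cliff}(D)$ over all divisors $D$ of degree $d$ on $\Gamma$ with $\operatorname{rank}(D)\geq 1$ and $\operatorname{rank}(D)-d+g\geq 2$. A chain of cycles of genus $g$ is the metric graph constructed as follows: take $g$ metric graphs $C_1,\dots,C_g$, each isometric to a circle; on each $C_i$ choose two distinct points $v_i,w_i$; for $1\leq i\leq g-1$ connect $w_i$ and $v_{i+1}$ by a line segment (of arbitrary length).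
   Formalization: For a chain of cycles of genus 3 with no divisor of degree 2 and rank 1, no divisor satisfies the conditions defining the Clifford index, so the minimum is undefined; there it is taken by convention as floor((g-1)/2) = 1. In all other cases the definition is as stated. *)

theory Defs
  imports Complex_Main "HOL-Library.Poly_Mapping" "Graph_Theory.Digraph_Component"
begin

section \<open>Metric graphs and their points\<close>

text \<open>
  A metric graph is presented by a finite connected multigraph (loops and parallel arcs allowed)
  with positive arc lengths. The orientation of an arc only serves to parametrise it by the
  interval from 0 (its tail) to its length (its head).
\<close>

record ('v, 'e) metric_graph =
  model :: "('v, 'e) pre_digraph"
  len :: "'e \<Rightarrow> real"

locale metric_graph = fin_digraph "model G" for G :: "('v, 'e) metric_graph" +
  assumes connected: "Digraph_Component.connected (model G)"
    and len_pos: "e \<in> arcs (model G) \<Longrightarrow> len G e > 0"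

datatype ('v, 'e) point = Vertex 'v | Inner 'e real

definition points :: "('v, 'e) metric_graph \<Rightarrow> ('v, 'e) point set" where
  "points G = Vertex ` verts (model G) \<union> {Inner e t | e t. e \<in> arcs (model G) \<and> 0 < t \<and> t < len G e}"

text \<open>The point at distance \<open>t\<close> from the tail along the arc \<open>e\<close>, for \<open>0 \<le> t \<le> len G e\<close>.\<close>

definition arc_point :: "('v, 'e) metric_graph \<Rightarrow> 'e \<Rightarrow> real \<Rightarrow> ('v, 'e) point" where
  "arc_point G e t =
     (if t \<le> 0 then Vertex (tail (model G) e) else if t \<ge> len G e then Vertex (head (model G) e) else Inner e t)"

definition genus :: "('v, 'e) metric_graph \<Rightarrow> int" where
  "genus G = int (card (arcs (model G))) - int (card (verts (model G))) + 1"


section \<open>Rational functions\<close>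

definition integer_piecewise_linear :: "real \<Rightarrow> (real \<Rightarrow> real) \<Rightarrow> bool" where
  "integer_piecewise_linear L h \<longleftrightarrow>
     continuous_on {0..L} h \<and>
     (\<exists>S. finite S \<and>
        (\<forall>x y. 0 \<le> x \<and> x < y \<and> y \<le> L \<and> {x<..<y} \<inter> S = {} \<longrightarrow>
           (\<exists>(m::int) c. \<forall>t\<in>{x<..<y}. h t = of_int m * t + c)))"

text \<open>Continuity on the whole metric graph is automatic from continuity along each closed arc.\<close>

definition rational_function :: "('v, 'e) metric_graph \<Rightarrow> (('v, 'e) point \<Rightarrow> real) \<Rightarrow> bool" where
  "rational_function G f \<longleftrightarrow>
     (\<forall>e\<in>arcs (model G). integer_piecewise_linear (len G e) (\<lambda>t. f (arc_point G e t)))"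

text \<open>The slope of \<open>h\<close> at \<open>t\<close> when leaving \<open>t\<close> in the direction \<open>d\<close>, where \<open>d\<close> is \<open>1\<close> or \<open>-1\<close>.\<close>

definition outgoing_slope :: "(real \<Rightarrow> real) \<Rightarrow> real \<Rightarrow> real \<Rightarrow> int" where
  "outgoing_slope h t d =
     (THE m. \<forall>\<^sub>F s in at_right 0. h (t + d * s) = h t + of_int m * s)"

text \<open>
  The coefficient at a point of the divisor of \<open>f\<close> is the sum of the outgoing slopes over all
  tangent directions at that point. A loop contributes two tangent directions to its vertex.
\<close>

fun ord_at :: "('v, 'e) metric_graph \<Rightarrow> (('v, 'e) point \<Rightarrow> real) \<Rightarrow> ('v, 'e) point \<Rightarrow> int" where
  "ord_at G f (Vertex v) =
     (\<Sum>e | e \<in> arcs (model G) \<and> tail (model G) e = v. outgoing_slope (\<lambda>t. f (arc_point G e t)) 0 1) +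
     (\<Sum>e | e \<in> arcs (model G) \<and> head (model G) e = v. outgoing_slope (\<lambda>t. f (arc_point G e t)) (len G e) (- 1))"
| "ord_at G f (Inner e t) =
     outgoing_slope (\<lambda>t. f (arc_point G e t)) t 1 + outgoing_slope (\<lambda>t. f (arc_point G e t)) t (- 1)"


section \<open>Divisors\<close>

type_synonym ('v, 'e) divisor = "('v, 'e) point \<Rightarrow>\<^sub>0 int"

definition divisor_on :: "('v, 'e) metric_graph \<Rightarrow> ('v, 'e) divisor \<Rightarrow> bool" where
  "divisor_on G D \<longleftrightarrow> Poly_Mapping.keys D \<subseteq> points G"

definition divisor_degree :: "('v, 'e) divisor \<Rightarrow> int" where
  "divisor_degree D = (\<Sum>p\<in>Poly_Mapping.keys D. Poly_Mapping.lookup D p)"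

definition effective :: "('v, 'e) divisor \<Rightarrow> bool" where
  "effective D \<longleftrightarrow> (\<forall>p. Poly_Mapping.lookup D p \<ge> 0)"

definition linearly_equivalent ::
  "('v, 'e) metric_graph \<Rightarrow> ('v, 'e) divisor \<Rightarrow> ('v, 'e) divisor \<Rightarrow> bool" where
  "linearly_equivalent G D D' \<longleftrightarrow>
     (\<exists>f. rational_function G f \<and>
        (\<forall>p\<in>points G. Poly_Mapping.lookup (D - D') p = ord_at G f p))"

definition divisor_rank :: "('v, 'e) metric_graph \<Rightarrow> ('v, 'e) divisor \<Rightarrow> int" where
  "divisor_rank G D =
     (if \<exists>D'. divisor_on G D' \<and> effective D' \<and> linearly_equivalent G D D'
      then int (GREATEST n. \<forall>E. divisor_on G E \<and> effective E \<and> divisor_degree E = int n \<longrightarrow>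
             (\<exists>D'. divisor_on G D' \<and> effective D' \<and> linearly_equivalent G D D' \<and>
                   effective (D' - E)))
      else - 1)"

definition gonality :: "('v, 'e) metric_graph \<Rightarrow> int" where
  "gonality G =
     (LEAST m. \<exists>D. divisor_on G D \<and> divisor_degree D = m \<and> divisor_rank G D \<ge> 1)"

definition clifford_index_divisor :: "('v, 'e) metric_graph \<Rightarrow> ('v, 'e) divisor \<Rightarrow> int" where
  "clifford_index_divisor G D = divisor_degree D - 2 * divisor_rank G D"

definition contributes_to_clifford_index ::
  "('v, 'e) metric_graph \<Rightarrow> ('v, 'e) divisor \<Rightarrow> bool" where
  "contributes_to_clifford_index G D \<longleftrightarrow>
     divisor_on G D \<and> divisor_rank G D \<ge> 1 \<and>
     divisor_rank G D - divisor_degree D + genus G \<ge> 2"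

text \<open>
  On some graphs no divisor contributes, so the minimum is undefined: in genus at least 3 this
  can happen for a chain of cycles only if it has genus 3 and is not hyperelliptic. As for
  algebraic curves, the Clifford index is then by convention the generic value, the floor of
  \<open>(g - 1) / 2\<close>; it is 1 in genus 3.
\<close>

definition clifford_index :: "('v, 'e) metric_graph \<Rightarrow> int" where
  "clifford_index G =
     (if \<exists>D. contributes_to_clifford_index G D
      then LEAST c. \<exists>D. contributes_to_clifford_index G D \<and> clifford_index_divisor G D = c
      else (genus G - 1) div 2)"


section \<open>Chains of cycles\<close>

text \<open>
  A circle with two distinct marked points \<open>V i\<close> and \<open>W i\<close> is the same as a pair of arcs
  \<open>Upper i\<close>, \<open>Lower i\<close> of positive lengths \<open>a i\<close>, \<open>b i\<close> joining the two points; its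
  circumference is \<open>a i + b i\<close>. The segment \<open>Bridge i\<close> of length \<open>l i\<close> joins \<open>W i\<close> to
  \<open>V (i + 1)\<close>.
\<close>

datatype chain_vertex = V nat | W nat

datatype chain_arc = Upper nat | Lower nat | Bridge nat

fun chain_tail :: "chain_arc \<Rightarrow> chain_vertex" where
  "chain_tail (Upper i) = V i"
| "chain_tail (Lower i) = V i"
| "chain_tail (Bridge i) = W i"

fun chain_head :: "chain_arc \<Rightarrow> chain_vertex" where
  "chain_head (Upper i) = W i"
| "chain_head (Lower i) = W i"
| "chain_head (Bridge i) = V (i + 1)"

definition chain_of_cycles ::
  "nat \<Rightarrow> (nat \<Rightarrow> real) \<Rightarrow> (nat \<Rightarrow> real) \<Rightarrow> (nat \<Rightarrow> real) \<Rightarrow> (chain_vertex, chain_arc) metric_graph"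
where
  "chain_of_cycles g a b l =
     \<lparr>model =
        \<lparr>verts = V ` {1..g} \<union> W ` {1..g},
         arcs = Upper ` {1..g} \<union> Lower ` {1..g} \<union> Bridge ` {1..<g},
         tail = chain_tail,
         head = chain_head\<rparr>,
      len = case_chain_arc a b l\<rparr>"

lemma genus_chain_of_cycles:
  assumes "g \<ge> 1"
  shows "genus (chain_of_cycles g a b l) = int g"
proof -
  have "card (V ` {1..g} \<union> W ` {1..g}) = card (V ` {1..g}) + card (W ` {1..g})"
    by (rule card_Un_disjoint) auto
  moreover have "card (Upper ` {1..g} \<union> Lower ` {1..g} \<union> Bridge ` {1..<g}) =
      card (Upper ` {1..g} \<union> Lower ` {1..g}) + card (Bridge ` {1..<g})"
    by (rule card_Un_disjoint) auto
  moreover have "card (Upper ` {1..g} \<union> Lower ` {1..g}) =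
      card (Upper ` {1..g}) + card (Lower ` {1..g})"
    by (rule card_Un_disjoint) auto
  ultimately show ?thesis
    using assms by (simp add: genus_def chain_of_cycles_def card_image inj_on_def of_nat_diff)
qed

lemma metric_graph_chain_of_cycles:
  assumes "g \<ge> 1"
    and "\<And>i. i \<in> {1..g} \<Longrightarrow> a i > 0"
    and "\<And>i. i \<in> {1..g} \<Longrightarrow> b i > 0"
    and "\<And>i. i \<in> {1..<g} \<Longrightarrow> l i > 0"
  shows "metric_graph (chain_of_cycles g a b l)"
proof -
  let ?G = "model (chain_of_cycles g a b l)"
  interpret fin_digraph ?G
    by unfold_locales (auto simp: chain_of_cycles_def)
  let ?S = "with_proj (mk_symmetric ?G)"
  interpret H: pair_wf_digraph "mk_symmetric ?G" ..
  have verts: "verts ?G = V ` {1..g} \<union> W ` {1..g}"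
    by (simp add: chain_of_cycles_def)
  have ends: "(chain_tail e, chain_head e) \<in> parcs (mk_symmetric ?G)"
      "(chain_head e, chain_tail e) \<in> parcs (mk_symmetric ?G)"
    if "e \<in> arcs ?G" for e
    using that by (auto simp: parcs_mk_symmetric chain_of_cycles_def)
  have *: "reachable ?S (V 1) (V i) \<and> reachable ?S (V i) (V 1) \<and>
      reachable ?S (V 1) (W i) \<and> reachable ?S (W i) (V 1)"
    if "i \<in> {1..g}" for i
    using that
  proof (induction i)
    case 0
    then show ?case by simp
  next
    case (Suc i)
    have up: "(V (Suc i), W (Suc i)) \<in> parcs (mk_symmetric ?G)" "(W (Suc i), V (Suc i)) \<in> parcs (mk_symmetric ?G)"
      using ends[of "Upper (Suc i)"] Suc.prems by (auto simp: chain_of_cycles_def)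
    have base: "reachable ?S (V 1) (V (Suc i)) \<and>
        reachable ?S (V (Suc i)) (V 1)"
    proof (cases "i = 0")
      case True
      then show ?thesis using assms(1) verts by (auto intro!: H.reachable_refl)
    next
      case False
      have "(W i, V (Suc i)) \<in> parcs (mk_symmetric ?G)" "(V (Suc i), W i) \<in> parcs (mk_symmetric ?G)"
        using ends[of "Bridge i"] Suc.prems False by (auto simp: chain_of_cycles_def)
      then show ?thesis
        using Suc.IH Suc.prems False by (auto intro: H.reachable_adj_trans H.adj_reachable_trans)
    qed
    then show ?case
      using up by (auto intro: H.reachable_adj_trans H.adj_reachable_trans)
  qed
  have to_from: "reachable ?S (V 1) u \<and> reachable ?S u (V 1)" if "u \<in> verts ?G" for u
    using that * unfolding verts by blast
  have "reachable ?S u v" if "u \<in> verts ?G" "v \<in> verts ?G" for u v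
    using to_from[OF that(1)] to_from[OF that(2)] H.reachable_trans by blast
  moreover have "verts ?G \<noteq> {}"
    using assms(1) verts by auto
  ultimately have "strongly_connected ?S"
    by (auto simp: strongly_connected_def)
  then have "Digraph_Component.connected ?G"
    by (simp add: Digraph_Component.connected_def)
  then show ?thesis
    by unfold_locales (use assms in \<open>auto simp: chain_of_cycles_def\<close>)
qed

end

(*
  Retract a point to the i-th cycle and measure its position there from W i: this gives a real
  coordinate modulo the circumference. Two divisors are linearly equivalent iff they have the same
  degree and, for every cycle, the same sum of coordinates. Hence whether a divisor has an effective
  representative is decided by carrying chips from cycle to cycle: one chip is lost on each cycle,
  unless the number of chips carried lies in a residue class determined by the divisor.

  Carrying 0, -1, ..., -r chips at once, a divisor of degree d and rank at least r yields a filling of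
  an (r + 1) x (g - d + r) rectangle by the numbers 1, ..., g, strictly increasing along rows and
  columns, in which an entry i is repeated only in cells whose contents differ by a torsion order of
  the i-th cycle (Pflueger's displacement tableaux). Conversely, a 2 x n filling gives a divisor of
  degree g - n + 1 and rank at least 1.

  A p x q filling with p, q >= 2 contains enough entries for a 2 x (p + q - 2) filling, obtained by
  choosing two adjacent cells on every antidiagonal. So a divisor contributing to the Clifford index
  produces one of rank at least 1 and degree d - 2 r + 2.
*)
theory Submission
  imports Defs
begin

section \<open>Displacement tableaux\<close>

text \<open>Two rows of a p x q filling are too short: with p = r + 1 and q = g - d + r, the degree
  d - 2 r + 2 = g - n + 1 requires n = p + q - 2 columns. Antidiagonals supply just enough entries:
  there are p + q - 1 of them, the two at the corners give one entry each and the others two, which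
  makes 2 n. The two entries from one antidiagonal are placed with the smaller one in the upper row,
  one column to the right of the larger one. This keeps their content difference 2, so a repetition
  that was allowed stays allowed. In the passage from rank to fillings the obstacle is that one
  effective divisor must be found for each bound. Columns become strict because an additional chip
  at \<open>W i\<close> shifts the class on the i-th cycle by \<open>a i\<close>, which is no
  multiple of the circumference.\<close>

definition displacement_tableau ::
  "(nat \<Rightarrow> int \<Rightarrow> bool) \<Rightarrow> nat \<Rightarrow> nat \<Rightarrow> nat \<Rightarrow> (nat \<Rightarrow> nat \<Rightarrow> nat) \<Rightarrow> bool" where
  "displacement_tableau T g p q t \<longleftrightarrow>
     (\<forall>x<p. \<forall>y<q. 1 \<le> t x y \<and> t x y \<le> g) \<and>
     (\<forall>x y. Suc x < p \<longrightarrow> y < q \<longrightarrow> t x y < t (Suc x) y) \<and>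
     (\<forall>x y. x < p \<longrightarrow> Suc y < q \<longrightarrow> t x y < t x (Suc y)) \<and>
     (\<forall>x<p. \<forall>y<q. \<forall>x'<p. \<forall>y'<q. t x y = t x' y' \<longrightarrow>
        T (t x y) ((int y - int x) - (int y' - int x')))"

section \<open>Two-row fillings inside larger ones\<close>

context
  fixes T :: "nat \<Rightarrow> int \<Rightarrow> bool" and g p q n :: nat and t :: "nat \<Rightarrow> nat \<Rightarrow> nat"
  assumes tab: "displacement_tableau T g p q t"
    and sym: "\<And>i z. T i z \<Longrightarrow> T i (- z)"
    and n_def: "n + 2 = p + q"
begin

lemma tab_range: "x < p \<Longrightarrow> y < q \<Longrightarrow> 1 \<le> t x y" "x < p \<Longrightarrow> y < q \<Longrightarrow> t x y \<le> g"
  and tab_down: "Suc x < p \<Longrightarrow> y < q \<Longrightarrow> t x y < t (Suc x) y"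
  and tab_right: "x < p \<Longrightarrow> Suc y < q \<Longrightarrow> t x y < t x (Suc y)"
  and tab_eq: "x < p \<Longrightarrow> y < q \<Longrightarrow> x' < p \<Longrightarrow> y' < q \<Longrightarrow> t x y = t x' y' \<Longrightarrow>
      z = (int y - int x) - (int y' - int x') \<Longrightarrow> T (t x y) z"
  using tab unfolding displacement_tableau_def by auto

lemma tab_right_less: "x < p \<Longrightarrow> y' < q \<Longrightarrow> y < y' \<Longrightarrow> t x y < t x y'"
proof (induction y')
  case (Suc y')
  then show ?case using tab_right[of x y'] by (cases "y = y'") (auto intro: less_trans)
qed simp

lemma tab_down_less: "x' < p \<Longrightarrow> y < q \<Longrightarrow> x < x' \<Longrightarrow> t x y < t x' y"
proof (induction x')
  case (Suc x')
  then show ?case using tab_down[of x' y] by (cases "x = x'") (auto intro: less_trans)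
qed simp

text \<open>What remains to be filled once the antidiagonals up to k (sum of the two indices) have
  been used: \<open>u\<close> is the upper row, \<open>v\<close> the lower one. Row \<open>v\<close>
  starts one column earlier because one antidiagonal supplies \<open>u (k + 1)\<close> and
  \<open>v k\<close>. The offset \<open>int i - int j + 1\<close> is the content of cell (0, i)
  minus that of cell (1, j).\<close>

definition completes :: "nat \<Rightarrow> nat \<Rightarrow> (nat \<Rightarrow> nat) \<Rightarrow> (nat \<Rightarrow> nat) \<Rightarrow> bool" where
  "completes k s u v \<longleftrightarrow>
     (\<forall>j. k < j \<longrightarrow> j < n \<longrightarrow> s < u j \<and> u j \<le> g \<and> u j < v j \<and> (Suc j < n \<longrightarrow> u j < u (Suc j))) \<and>
     (\<forall>j. k \<le> j \<longrightarrow> j < n \<longrightarrow> s < v j \<and> v j \<le> g \<and> (Suc j < n \<longrightarrow> v j < v (Suc j))) \<and>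
     (\<forall>i j. k < i \<longrightarrow> i < n \<longrightarrow> k \<le> j \<longrightarrow> j < n \<longrightarrow> u i = v j \<longrightarrow> T (u i) (int i - int j + 1))"

text \<open>
  Two cells that are adjacent on an antidiagonal are followed to the next antidiagonal. They share
  one successor; the other one is chosen below the larger of the two entries, so that entries on
  different antidiagonals never coincide. On reaching the border of the rectangle, the remaining
  moves are read off from the last two rows or columns.
\<close>

lemma completes_exists:
  assumes "x + 1 < p" "y + 1 < q" "s < t x (Suc y)" "s < t (Suc x) y"
  shows "\<exists>u v. completes (x + y) s u v"
  using assms
proof (induction "(p - x) + (q - y)" arbitrary: x y s rule: less_induct)
  case less
  consider "Suc (Suc x) = p" | "Suc (Suc y) = q" | "Suc (Suc x) < p" "Suc (Suc y) < q"
    using less.prems by linarith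
  then show ?case
  proof cases
    case 1
    \<comment> \<open>The last two rows are used as they are. Cell (x, j - x) goes to column j,
      which changes all contents by the same constant.\<close>
    define u where "u = (\<lambda>j. t x (j - x))"
    define v where "v = (\<lambda>j. t (Suc x) (j - x))"
    have U: "s < u j" if "x + y < j" "j < n" for j
      using less.prems(3) tab_right_less[of x "j - x" "Suc y"] that n_def 1
      by (cases "j - x = Suc y") (auto simp: u_def intro: less_trans)
    have V: "s < v j" if "x + y \<le> j" "j < n" for j
      using less.prems(4) tab_right_less[of "Suc x" "j - x" y] that n_def 1
      by (cases "j - x = y") (auto simp: v_def intro: less_trans)
    have "completes (x + y) s u v"
      unfolding completes_def
    proof (intro conjI allI impI)
      fix j assume j: "x + y < j" "j < n"
      show "s < u j" using U j by blast
      show "u j \<le> g" using j n_def 1 by (auto simp: u_def intro!: tab_range)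
      show "u j < v j" using j n_def 1 by (auto simp: u_def v_def intro!: tab_down)
      show "u j < u (Suc j)" if "Suc j < n"
        using that j n_def 1 by (auto simp: u_def intro!: tab_right_less)
    next
      fix j assume j: "x + y \<le> j" "j < n"
      show "s < v j" using V j by blast
      show "v j \<le> g" using j n_def 1 by (auto simp: v_def intro!: tab_range)
      show "v j < v (Suc j)" if "Suc j < n"
        using that j n_def 1 by (auto simp: v_def intro!: tab_right_less)
    next
      fix i j assume ij: "x + y < i" "i < n" "x + y \<le> j" "j < n" "u i = v j"
      show "T (u i) (int i - int j + 1)"
        unfolding u_def
        by (rule tab_eq[where x' = "Suc x" and y' = "j - x"])
          (use ij n_def 1 in \<open>auto simp: u_def v_def\<close>)
    qed
    then show ?thesis by blast
  next
    case 2
    \<comment> \<open>The transposed border case: the last two columns become rows. Content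
      differences change sign, hence the appeal to \<open>sym\<close> below.\<close>
    define u where "u = (\<lambda>j. t (j - y) y)"
    define v where "v = (\<lambda>j. t (j - y) (Suc y))"
    have U: "s < u j" if "x + y < j" "j < n" for j
      using less.prems(4) tab_down_less[of "j - y" y "Suc x"] that n_def 2
      by (cases "j - y = Suc x") (auto simp: u_def intro: less_trans)
    have V: "s < v j" if "x + y \<le> j" "j < n" for j
      using less.prems(3) tab_down_less[of "j - y" "Suc y" x] that n_def 2
      by (cases "j - y = x") (auto simp: v_def intro: less_trans)
    have "completes (x + y) s u v"
      unfolding completes_def
    proof (intro conjI allI impI)
      fix j assume j: "x + y < j" "j < n"
      show "s < u j" using U j by blast
      show "u j \<le> g" using j n_def 2 by (auto simp: u_def intro!: tab_range)
      show "u j < v j" using j n_def 2 by (auto simp: u_def v_def intro!: tab_right)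
      show "u j < u (Suc j)" if "Suc j < n"
        using that j n_def 2 by (auto simp: u_def intro!: tab_down_less)
    next
      fix j assume j: "x + y \<le> j" "j < n"
      show "s < v j" using V j by blast
      show "v j \<le> g" using j n_def 2 by (auto simp: v_def intro!: tab_range)
      show "v j < v (Suc j)" if "Suc j < n"
        using that j n_def 2 by (auto simp: v_def intro!: tab_down_less)
    next
      fix i j assume ij: "x + y < i" "i < n" "x + y \<le> j" "j < n" "u i = v j"
      have "T (u i) (- (int i - int j + 1))"
        unfolding u_def
        by (rule tab_eq[where x' = "j - y" and y' = "Suc y"])
          (use ij n_def 2 in \<open>auto simp: u_def v_def\<close>)
      from sym[OF this] show "T (u i) (int i - int j + 1)" by (simp add: algebra_simps)
    qed
    then show ?thesis by blast
  next
    case 3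
    define \<alpha> where "\<alpha> = t x (Suc y)"
    define \<beta> where "\<beta> = t (Suc x) y"
    \<comment> \<open>The walk continues with the two successors of the cell holding the larger
      entry, so both exceed \<open>s'\<close>. Everything chosen later is then above both current
      entries.\<close>
    define s' where "s' = max \<alpha> \<beta>"
    have mid: "s' < t (Suc x) (Suc y)"
      using tab_down[of x "Suc y"] tab_right[of "Suc x" y] 3 by (auto simp: s'_def \<alpha>_def \<beta>_def)
    have "\<exists>u v. completes (Suc (x + y)) s' u v"
    proof (cases "\<alpha> \<le> \<beta>")
      case True
      have "\<exists>u v. completes (Suc x + y) s' u v"
        by (rule less.hyps) (use 3 mid True tab_down[of "Suc x" y] in \<open>auto simp: s'_def \<beta>_def\<close>)
      then show ?thesis by simp
    next
      case False
      have "\<exists>u v. completes (x + Suc y) s' u v"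
        by (rule less.hyps) (use 3 mid False tab_right[of x "Suc y"] in \<open>auto simp: s'_def \<alpha>_def\<close>)
      then show ?thesis by simp
    qed
    then obtain u v where uv: "completes (Suc (x + y)) s' u v" by blast
    let ?k = "x + y"
    define u' where "u' = u(Suc ?k := min \<alpha> \<beta>)"
    define v' where "v' = v(?k := s')"
    have bounds: "s < min \<alpha> \<beta>" "min \<alpha> \<beta> \<le> s'" "s' \<le> g"
      using less.prems tab_range(2)[of x "Suc y"] tab_range(2)[of "Suc x" y] 3
      by (auto simp: \<alpha>_def \<beta>_def s'_def)
    have two: "T \<alpha> 2" if "\<alpha> = \<beta>"
      unfolding \<alpha>_def
      by (rule tab_eq[where x' = "Suc x" and y' = y]) (use that 3 in \<open>auto simp: \<alpha>_def \<beta>_def\<close>)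
    have U: "s' < u j \<and> u j \<le> g \<and> u j < v j \<and> (Suc j < n \<longrightarrow> u j < u (Suc j))"
      if "Suc ?k < j" "j < n" for j using uv that by (auto simp: completes_def)
    have V: "s' < v j \<and> v j \<le> g \<and> (Suc j < n \<longrightarrow> v j < v (Suc j))"
      if "Suc ?k \<le> j" "j < n" for j using uv that by (auto simp: completes_def)
    have UV: "T (u i) (int i - int j + 1)"
      if "Suc ?k < i" "i < n" "Suc ?k \<le> j" "j < n" "u i = v j" for i j
      using uv that by (auto simp: completes_def)
    have "completes ?k s u' v'"
      unfolding completes_def
    proof (intro conjI allI impI)
      fix j assume j: "?k < j" "j < n"
      show "s < u' j" using U[of j] j bounds by (cases "j = Suc ?k") (auto simp: u'_def)
      show "u' j \<le> g" using U[of j] j bounds by (cases "j = Suc ?k") (auto simp: u'_def)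
      show "u' j < v' j" using U[of j] V[of j] j bounds
        by (cases "j = Suc ?k") (auto simp: u'_def v'_def)
      show "u' j < u' (Suc j)" if "Suc j < n"
        using that U[of j] U[of "Suc j"] j bounds by (cases "j = Suc ?k") (auto simp: u'_def)
    next
      fix j assume j: "?k \<le> j" "j < n"
      show "s < v' j" using V[of j] j bounds by (cases "j = ?k") (auto simp: v'_def)
      show "v' j \<le> g" using V[of j] j bounds by (cases "j = ?k") (auto simp: v'_def)
      show "v' j < v' (Suc j)" if "Suc j < n"
        using that V[of j] V[of "Suc j"] j bounds by (cases "j = ?k") (auto simp: v'_def)
    next
      fix i j assume ij: "?k < i" "i < n" "?k \<le> j" "j < n" "u' i = v' j"
      show "T (u' i) (int i - int j + 1)"
      proof (cases "i = Suc ?k")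
        case True
        have "j = ?k" using ij True V[of j] bounds by (auto simp: u'_def v'_def split: if_splits)
        with True ij two show ?thesis by (auto simp: u'_def v'_def s'_def min_def max_def split: if_splits)
      next
        case False
        with ij U[of i] have "j \<noteq> ?k" by (auto simp: u'_def v'_def split: if_splits)
        with False ij UV[of i j] show ?thesis by (auto simp: u'_def v'_def)
      qed
    qed
    then show ?thesis by blast
  qed
qed

text \<open>The pairs begin on antidiagonal 1; the corner entry \<open>t 0 0\<close> fills the one
  cell left over, column 0 of the upper row.\<close>

lemma two_row_tableau_exists:
  assumes "2 \<le> p" "2 \<le> q" "\<And>i. T i 0"
  shows "\<exists>t'. displacement_tableau T g 2 n t'"
proof -
  have "\<exists>u v. completes (0 + 0) (t 0 0) u v"
    by (rule completes_exists) (use assms tab_right[of 0 0] tab_down[of 0 0] in auto)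
  then obtain u v where uv: "completes 0 (t 0 0) u v" by auto
  define u' where "u' = u(0 := t 0 0)"
  have n: "2 \<le> n" using n_def assms by simp
  have U: "t 0 0 < u j \<and> u j \<le> g \<and> u j < v j \<and> (Suc j < n \<longrightarrow> u j < u (Suc j))"
    if "0 < j" "j < n" for j using uv that by (auto simp: completes_def)
  have V: "t 0 0 < v j \<and> v j \<le> g \<and> (Suc j < n \<longrightarrow> v j < v (Suc j))"
    if "j < n" for j using uv that by (auto simp: completes_def)
  have UV: "T (u i) (int i - int j + 1)"
    if "0 < i" "i < n" "j < n" "u i = v j" for i j
    using uv that by (auto simp: completes_def)
  have t0: "1 \<le> t 0 0" "t 0 0 \<le> g" using tab_range[of 0 0] assms by auto
  have U': "1 \<le> u' j \<and> u' j \<le> g \<and> u' j < v j \<and> (Suc j < n \<longrightarrow> u' j < u' (Suc j))"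
    if "j < n" for j
    using U[of j] U[of "Suc j"] V[of j] that t0 by (cases "j = 0") (auto simp: u'_def)
  have UV': "T (u' i) (int i - int j + 1)" if "i < n" "j < n" "u' i = v j" for i j
    using UV[of i j] V[of j] that by (cases "i = 0") (auto simp: u'_def)
  have inj: "i = j" if "i < n" "j < n" "u' i = u' j" for i j
  proof -
    have "u' i < u' j" if "i < j" "j < n" for i j
      using that
    proof (induction j)
      case (Suc j)
      then show ?case using U'[of j] by (cases "i = j") (auto intro: less_trans)
    qed simp
    with that show ?thesis by (metis linorder_neqE_nat nat_neq_iff)
  qed
  have inj': "i = j" if "i < n" "j < n" "v i = v j" for i j
  proof -
    have "v i < v j" if "i < j" "j < n" for i j
      using that
    proof (induction j)
      case (Suc j)
      then show ?case using V[of j] by (cases "i = j") (auto intro: less_trans)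
    qed simp
    with that show ?thesis by (metis linorder_neqE_nat nat_neq_iff)
  qed
  have lt2: "x < 2 \<longleftrightarrow> x = 0 \<or> x = 1" for x :: nat by auto
  define t' where "t' = (\<lambda>x::nat. if x = 0 then u' else v)"
  have "displacement_tableau T g 2 n t'"
    unfolding displacement_tableau_def
  proof (intro conjI allI impI)
    fix x y :: nat assume "x < 2" "y < n"
    then show "1 \<le> t' x y" "t' x y \<le> g"
      using U'[of y] V[of y] by (auto simp: t'_def)
  next
    fix x y :: nat assume "Suc x < 2" "y < n"
    then show "t' x y < t' (Suc x) y" using U'[of y] by (auto simp: t'_def)
  next
    fix x y :: nat assume "x < 2" "Suc y < n"
    then show "t' x y < t' x (Suc y)" using U'[of y] V[of y] by (auto simp: t'_def)
  next
    fix x y x' y' :: nat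
    assume A: "x < 2" "y < n" "x' < 2" "y' < n" "t' x y = t' x' y'"
    consider "x = 0" "x' = 0" | "x = 1" "x' = 1" | "x = 0" "x' = 1" | "x = 1" "x' = 0"
      using A lt2 by auto
    then show "T (t' x y) (int y - int x - (int y' - int x'))"
    proof cases
      case 1
      with A inj[of y y'] assms(3) show ?thesis by (auto simp: t'_def)
    next
      case 2
      with A inj'[of y y'] assms(3) show ?thesis by (auto simp: t'_def)
    next
      case 3
      with A UV'[of y y'] show ?thesis by (auto simp: t'_def algebra_simps)
    next
      case 4
      with A UV'[of y' y] have "T (t' x y) (- (int y' - int y + 1))"
        by (intro sym) (auto simp: t'_def)
      with 4 show ?thesis by (simp add: algebra_simps)
    qed
  qed
  then show ?thesis by blast
qed

end

text \<open>All entries are distinct, so the condition on repetitions only compares a cell with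
  itself. This filling yields the generic gonality bound, the floor of (g + 3) / 2.\<close>

lemma trivial_two_row_tableau:
  assumes "\<And>i. T i 0"
  shows "displacement_tableau T g 2 (g div 2) (\<lambda>x y. 2 * y + x + 1)"
proof -
  have eq: "x = x' \<and> y = y'" if "x < 2" "x' < 2" "2 * y + x = 2 * y' + x'" for x y x' y' :: nat
    using that by presburger
  have le: "2 * y + x + 1 \<le> g" if "x < 2" "y < g div 2" for x y
    using that by presburger
  show ?thesis
    unfolding displacement_tableau_def
  proof (intro conjI allI impI)
    fix x y x' y' :: nat
    assume "x < 2" "x' < 2" "2 * y + x + 1 = 2 * y' + x' + 1"
    with eq[of x x' y y'] assms
    show "T (2 * y + x + 1) (int y - int x - (int y' - int x'))" by simp
  qed (use le in auto)
qed


section \<open>Piecewise linear functions on an interval\<close>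

text \<open>A relational form of \<open>outgoing_slope\<close>: slopes of sums and multiples can be
  computed in it without first showing that the definite description denotes anything.\<close>

definition germ :: "(real \<Rightarrow> real) \<Rightarrow> real \<Rightarrow> real \<Rightarrow> int \<Rightarrow> bool" where
  "germ h t d m \<longleftrightarrow> (\<forall>\<^sub>F s in at_right 0. h (t + d * s) = h t + of_int m * s)"

lemma germ_unique: "germ h t d m \<Longrightarrow> germ h t d m' \<Longrightarrow> m = m'"
proof -
  assume "germ h t d m" "germ h t d m'"
  then have "\<forall>\<^sub>F s in at_right (0::real). of_int m * s = of_int m' * s"
    unfolding germ_def by eventually_elim auto
  moreover have "\<forall>\<^sub>F s in at_right (0::real). s > 0" by (simp add: eventually_at_right_less)
  ultimately have "\<forall>\<^sub>F s in at_right (0::real). m = m'" by eventually_elim auto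
  then show ?thesis by simp
qed

lemma outgoing_slope_eqI: "germ h t d m \<Longrightarrow> outgoing_slope h t d = m"
  unfolding outgoing_slope_def
  by (rule the_equality) (auto simp: germ_def[symmetric] intro: germ_unique)

lemma germ_add:
  assumes "germ h t d m" "germ k t d m'"
  shows "germ (\<lambda>x. h x + k x) t d (m + m')"
  using assms unfolding germ_def by eventually_elim (simp add: algebra_simps)

lemma germ_scale:
  assumes "germ h t d m"
  shows "germ (\<lambda>x. of_int c * h x) t d (c * m)"
  using assms unfolding germ_def by eventually_elim (simp add: algebra_simps)

lemma germ_diff:
  assumes "germ h t d m" "germ k t d m'"
  shows "germ (\<lambda>x. h x - k x) t d (m - m')"
  using assms unfolding germ_def by eventually_elim (simp add: algebra_simps)

lemma germ_const: "germ (\<lambda>_. c) t d 0"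
  by (simp add: germ_def)

lemma germ_linear: "germ (\<lambda>x. of_int m * x) t 1 m" "germ (\<lambda>x. of_int m * x) t (- 1) (- m)"
  by (simp_all add: germ_def algebra_simps)

lemma germ_sum:
  "finite K \<Longrightarrow> (\<And>s. s \<in> K \<Longrightarrow> germ (h s) t d (m s)) \<Longrightarrow>
     germ (\<lambda>x. \<Sum>s\<in>K. h s x) t d (\<Sum>s\<in>K. m s)"
  by (induction K rule: finite_induct) (auto intro: germ_const germ_add)

lemma germ_cong:
  assumes "\<And>x. x \<in> {0..L} \<Longrightarrow> h x = k x" and "0 \<le> t" "t \<le> L"
    and "d = 1 \<and> t < L \<or> d = - 1 \<and> 0 < t"
  shows "germ h t d m \<longleftrightarrow> germ k t d m"
proof -
  have "\<forall>\<^sub>F s in at_right (0::real). s < (if d = 1 then L - t else t)"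
    by (rule eventually_at_rightI[of 0 "if d = 1 then L - t else t"]) (use assms in auto)
  moreover have "\<forall>\<^sub>F s in at_right (0::real). s > 0" by (simp add: eventually_at_right_less)
  ultimately have "\<forall>\<^sub>F s in at_right 0. t + d * s \<in> {0..L}"
    by eventually_elim (use assms in \<open>auto split: if_splits\<close>)
  then have *: "\<forall>\<^sub>F s in at_right 0. h (t + d * s) = k (t + d * s)"
    by eventually_elim (use assms in auto)
  have "h t = k t" using assms by auto
  from * have "\<forall>\<^sub>F s in at_right 0.
      (h (t + d * s) = h t + of_int m * s) = (k (t + d * s) = k t + of_int m * s)"
    by (rule eventually_mono) (simp only: \<open>h t = k t\<close>)
  then show ?thesis
    unfolding germ_def by (rule eventually_subst)
qed

lemma eventually_less_at_right:
  assumes "0 < (e::real)" shows "\<forall>\<^sub>F s in at_right 0. 0 < s \<and> s < e"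
  by (rule eventually_at_rightI[of 0 e]) (use assms in auto)

lemma germ_hinge:
  "germ (\<lambda>x. max 0 (x - s)) t 1 (if s \<le> t then 1 else 0)"
  "germ (\<lambda>x. max 0 (x - s)) t (- 1) (if s < t then - 1 else 0)"
proof -
  show "germ (\<lambda>x. max 0 (x - s)) t 1 (if s \<le> t then 1 else 0)"
  proof (cases "s \<le> t")
    case True
    then show ?thesis
      using eventually_less_at_right[of 1] by (auto simp: germ_def elim!: eventually_mono)
  next
    case False
    then show ?thesis
      using eventually_less_at_right[of "s - t"] by (auto simp: germ_def elim!: eventually_mono)
  qed
  show "germ (\<lambda>x. max 0 (x - s)) t (- 1) (if s < t then - 1 else 0)"
  proof (cases "s < t")
    case True
    then show ?thesis
      using eventually_less_at_right[of "t - s"] by (auto simp: germ_def elim!: eventually_mono)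
  next
    case False
    then show ?thesis
      using eventually_less_at_right[of 1] by (auto simp: germ_def elim!: eventually_mono)
  qed
qed

text \<open>Each hinge makes the slope jump by \<open>\<delta> s\<close> at \<open>s\<close>; these
  jumps are the coefficients of a divisor along an arc. For \<open>K\<close> inside the positive
  reals, \<open>c\<close> and \<open>m\<close> are the value and the initial slope at 0.\<close>

definition broken_line :: "real \<Rightarrow> int \<Rightarrow> (real \<Rightarrow> int) \<Rightarrow> real set \<Rightarrow> real \<Rightarrow> real" where
  "broken_line c m \<delta> K t = c + of_int m * t + (\<Sum>s\<in>K. of_int (\<delta> s) * max 0 (t - s))"

lemma germ_broken_line:
  assumes "finite K"
  shows "germ (broken_line c m \<delta> K) t 1 (m + (\<Sum>s\<in>{s\<in>K. s \<le> t}. \<delta> s))"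
    and "germ (broken_line c m \<delta> K) t (- 1) (- (m + (\<Sum>s\<in>{s\<in>K. s < t}. \<delta> s)))"
proof -
  have "germ (\<lambda>t. c + of_int m * t + (\<Sum>s\<in>K. of_int (\<delta> s) * max 0 (t - s))) t 1
      (0 + m + (\<Sum>s\<in>K. \<delta> s * (if s \<le> t then 1 else 0)))"
    by (intro germ_add germ_const germ_linear germ_sum assms germ_scale germ_hinge)
  moreover have "(\<Sum>s\<in>K. \<delta> s * (if s \<le> t then 1 else 0)) = (\<Sum>s\<in>{s\<in>K. s \<le> t}. \<delta> s)"
    using assms by (simp add: sum.inter_filter if_distrib cong: if_cong)
  ultimately show "germ (broken_line c m \<delta> K) t 1 (m + (\<Sum>s\<in>{s\<in>K. s \<le> t}. \<delta> s))"
    by (simp add: broken_line_def[abs_def])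
  have "germ (\<lambda>t. c + of_int m * t + (\<Sum>s\<in>K. of_int (\<delta> s) * max 0 (t - s))) t (- 1)
      (0 + (- m) + (\<Sum>s\<in>K. \<delta> s * (if s < t then - 1 else 0)))"
    by (intro germ_add germ_const germ_linear germ_sum assms germ_scale germ_hinge)
  moreover have "(\<Sum>s\<in>K. \<delta> s * (if s < t then - 1 else 0)) = - (\<Sum>s\<in>{s\<in>K. s < t}. \<delta> s)"
    using assms by (simp add: sum.inter_filter if_distrib sum_negf[symmetric] cong: if_cong)
  ultimately show "germ (broken_line c m \<delta> K) t (- 1) (- (m + (\<Sum>s\<in>{s\<in>K. s < t}. \<delta> s)))"
    by (simp add: broken_line_def[abs_def])
qed

lemma integer_piecewise_linear_broken_line:
  assumes "finite K"
  shows "integer_piecewise_linear L (broken_line c m \<delta> K)"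
  unfolding integer_piecewise_linear_def
proof (intro conjI exI[of _ K] allI impI assms)
  show "continuous_on {0..L} (broken_line c m \<delta> K)"
    unfolding broken_line_def[abs_def] by (intro continuous_intros)
  fix x y :: real assume xy: "0 \<le> x \<and> x < y \<and> y \<le> L \<and> {x<..<y} \<inter> K = {}"
  let ?M = "m + (\<Sum>s\<in>{s\<in>K. s \<le> x}. \<delta> s)"
  let ?c = "c - (\<Sum>s\<in>{s\<in>K. s \<le> x}. of_int (\<delta> s) * s)"
  have "broken_line c m \<delta> K t = of_int ?M * t + ?c" if t: "t \<in> {x<..<y}" for t
  proof -
    have "(\<Sum>s\<in>K. of_int (\<delta> s) * max 0 (t - s)) = (\<Sum>s\<in>K. if s \<le> x then of_int (\<delta> s) * (t - s) else 0)"
    proof (rule sum.cong)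
      fix s assume "s \<in> K"
      with xy have "s \<le> x \<or> s \<ge> y" by (force simp: disjoint_iff)
      with t xy show "of_int (\<delta> s) * max 0 (t - s) = (if s \<le> x then of_int (\<delta> s) * (t - s) else 0)"
        by auto
    qed simp
    also have "\<dots> = (\<Sum>s\<in>{s\<in>K. s \<le> x}. of_int (\<delta> s) * (t - s))"
      using assms by (simp add: sum.inter_filter)
    also have "\<dots> = of_int (\<Sum>s\<in>{s\<in>K. s \<le> x}. \<delta> s) * t - (\<Sum>s\<in>{s\<in>K. s \<le> x}. of_int (\<delta> s) * s)"
      by (simp add: algebra_simps sum_subtractf sum_distrib_left)
    finally show ?thesis by (simp add: broken_line_def algebra_simps)
  qed
  then show "\<exists>(m'::int) c'. \<forall>t\<in>{x<..<y}. broken_line c m \<delta> K t = of_int m' * t + c'" by blast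
qed

lemma integer_piecewise_linear_cong:
  assumes "\<And>x. x \<in> {0..L} \<Longrightarrow> h x = k x" and "integer_piecewise_linear L k"
  shows "integer_piecewise_linear L h"
proof -
  obtain S where S: "finite S" "\<And>x y. 0 \<le> x \<and> x < y \<and> y \<le> L \<and> {x<..<y} \<inter> S = {} \<Longrightarrow>
      \<exists>(m::int) c. \<forall>t\<in>{x<..<y}. k t = of_int m * t + c"
    and cont: "continuous_on {0..L} k"
    using assms(2) unfolding integer_piecewise_linear_def by metis
  have "\<exists>(m::int) c. \<forall>t\<in>{x<..<y}. h t = of_int m * t + c"
    if xy: "0 \<le> x \<and> x < y \<and> y \<le> L \<and> {x<..<y} \<inter> S = {}" for x y
  proof -
    obtain m :: int and c where "\<forall>t\<in>{x<..<y}. k t = of_int m * t + c" using S(2)[OF xy] by blast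
    with xy have "\<forall>t\<in>{x<..<y}. h t = of_int m * t + c" by (simp add: assms(1))
    then show ?thesis by blast
  qed
  moreover have "continuous_on {0..L} h"
    using cont by (subst continuous_on_cong[OF refl assms(1)])
  ultimately show ?thesis
    unfolding integer_piecewise_linear_def using S(1) by (intro conjI exI[of _ S] allI impI)
qed

lemma integer_piecewise_linear_germ:
  assumes h: "integer_piecewise_linear L h" and t: "0 \<le> t" "t \<le> L"
    and d: "d = 1 \<and> t < L \<or> d = - 1 \<and> 0 < t"
  shows "\<exists>m. germ h t d m"
proof -
  obtain S where S: "finite S" "\<And>x y. 0 \<le> x \<Longrightarrow> x < y \<Longrightarrow> y \<le> L \<Longrightarrow> {x<..<y} \<inter> S = {} \<Longrightarrow>
      \<exists>(m::int) c. \<forall>t\<in>{x<..<y}. h t = of_int m * t + c"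
    and cont: "continuous_on {0..L} h"
    using h unfolding integer_piecewise_linear_def by metis
  obtain e where e: "0 < e" "\<And>s. s \<in> S \<Longrightarrow> s \<noteq> t \<Longrightarrow> e \<le> dist s t"
  proof
    show "0 < Min (insert 1 ((\<lambda>s. dist s t) ` (S - {t})))" using S(1) by simp
    show "Min (insert 1 ((\<lambda>s. dist s t) ` (S - {t}))) \<le> dist s t" if "s \<in> S" "s \<noteq> t" for s
      using S(1) that by (intro Min_le) auto
  qed
  have lim: "(h \<longlongrightarrow> h t) (at t within {0..L})"
    using cont t by (auto simp: continuous_on_def)
  show ?thesis
  proof (cases "d = 1")
    case True
    define y where "y = min L (t + e)"
    have y: "t < y" "y \<le> L" "y \<le> t + e" using True d e by (auto simp: y_def)
    have "{t<..<y} \<inter> S = {}" using e(2) y by (force simp: dist_real_def)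
    from S(2)[OF t(1) y(1,2) this] obtain m :: int and c
      where mc: "\<And>s. s \<in> {t<..<y} \<Longrightarrow> h s = of_int m * s + c" by blast
    \<comment> \<open>The affine formula is known only on an open interval; continuity extends it to
      the end point \<open>t\<close>, from which the germ starts.\<close>
    have "(h \<longlongrightarrow> h t) (at t within {t..y})"
      using lim by (rule tendsto_within_subset) (use t y in auto)
    then have "((\<lambda>s. of_int m * s + c) \<longlongrightarrow> h t) (at t within {t..y})"
      by (rule Lim_transform_within[where d = "y - t"]) (use y(1) in \<open>auto simp: mc dist_real_def\<close>)
    moreover have "((\<lambda>s. of_int m * s + c) \<longlongrightarrow> of_int m * t + c) (at t within {t..y})"
      by (intro tendsto_intros)
    moreover have "at t within {t..y} \<noteq> bot"
      using y(1) by (simp add: at_within_Icc_at_right)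
    ultimately have ht: "h t = of_int m * t + c" using tendsto_unique by blast
    have "germ h t d m"
      unfolding germ_def using eventually_less_at_right[of "y - t"] y(1) True
      by (auto elim!: eventually_mono simp: ht mc algebra_simps)
    then show ?thesis by blast
  next
    case False
    with d have d: "d = - 1" "0 < t" by auto
    define y where "y = max 0 (t - e)"
    have y: "y < t" "0 \<le> y" "t - e \<le> y" using d e by (auto simp: y_def)
    have "{y<..<t} \<inter> S = {}" using e(2) y by (force simp: dist_real_def)
    from S(2)[OF y(2,1) t(2) this] obtain m :: int and c
      where mc: "\<And>s. s \<in> {y<..<t} \<Longrightarrow> h s = of_int m * s + c" by blast
    have "(h \<longlongrightarrow> h t) (at t within {y..t})"
      using lim by (rule tendsto_within_subset) (use t y in auto)
    then have "((\<lambda>s. of_int m * s + c) \<longlongrightarrow> h t) (at t within {y..t})"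
      by (rule Lim_transform_within[where d = "t - y"]) (use y(1) in \<open>auto simp: mc dist_real_def\<close>)
    moreover have "((\<lambda>s. of_int m * s + c) \<longlongrightarrow> of_int m * t + c) (at t within {y..t})"
      by (intro tendsto_intros)
    moreover have "at t within {y..t} \<noteq> bot"
      using y(1) by (simp add: at_within_Icc_at_left)
    ultimately have ht: "h t = of_int m * t + c" using tendsto_unique by blast
    have "germ h t d (- m)"
      unfolding germ_def using eventually_less_at_right[of "t - y"] y(1) d
      by (auto elim!: eventually_mono simp: ht mc algebra_simps)
    then show ?thesis by blast
  qed
qed

lemma germ_outgoing_slope:
  assumes "integer_piecewise_linear L h" "0 \<le> t" "t \<le> L" "d = 1 \<and> t < L \<or> d = - 1 \<and> 0 < t"
  shows "germ h t d (outgoing_slope h t d)"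
  using integer_piecewise_linear_germ[OF assms] outgoing_slope_eqI by metis

section \<open>Uniqueness of a function with given bends\<close>

lemma germ_imp_linear:
  assumes "germ h t 1 m" "germ h t (- 1) (- m)"
  shows "\<exists>e>0. \<forall>s. \<bar>s - t\<bar> < e \<longrightarrow> h s = h t + of_int m * (s - t)"
proof -
  obtain e1 where e1: "0 < e1" "\<And>s. 0 < s \<Longrightarrow> s < e1 \<Longrightarrow> h (t + s) = h t + of_int m * s"
    using assms(1) by (auto simp: germ_def eventually_at_right_field)
  obtain e2 where e2: "0 < e2" "\<And>s. 0 < s \<Longrightarrow> s < e2 \<Longrightarrow> h (t - s) = h t - of_int m * s"
    using assms(2) by (auto simp: germ_def eventually_at_right_field)
  have "h s = h t + of_int m * (s - t)" if "\<bar>s - t\<bar> < min e1 e2" for s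
  proof -
    consider "s = t" | "s < t" | "t < s" by linarith
    then show ?thesis
      using e1(2)[of "s - t"] e2(2)[of "t - s"] that by cases (auto simp: algebra_simps)
  qed
  moreover have "0 < min e1 e2" using e1(1) e2(1) by simp
  ultimately show ?thesis by blast
qed

lemma linear_imp_germ:
  assumes "\<And>u. \<bar>u - s\<bar> < e \<Longrightarrow> h u = h s + of_int m * (u - s)" "0 < e"
  shows "germ h s 1 m"
proof -
  have "h (s + x) = h s + of_int m * x" if "0 < x \<and> x < e" for x
    using assms(1)[of "s + x"] that by simp
  then show ?thesis
    unfolding germ_def using eventually_mono[OF eventually_less_at_right[OF assms(2)]] by simp
qed

text \<open>Without bends the slope is locally constant, hence constant on the connected open
  interval, and it is 0 near the left end. Then the function itself is locally constant inside; the
  end points are attached through the germs given there.\<close>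

lemma constant_if_germs_cancel:
  assumes "0 < L"
    and inner: "\<And>t. t \<in> {0<..<L} \<Longrightarrow> \<exists>m. germ k t 1 m \<and> germ k t (- 1) (- m)"
    and left: "germ k 0 1 0" and right: "germ k L (- 1) c"
  shows "t \<in> {0..L} \<Longrightarrow> k t = k 0" and "c = 0"
proof -
  define \<sigma> where "\<sigma> t = outgoing_slope k t 1" for t
  have \<sigma>: "germ k t 1 (\<sigma> t) \<and> germ k t (- 1) (- \<sigma> t)" if t: "t \<in> {0<..<L}" for t
  proof -
    obtain m where "germ k t 1 m" "germ k t (- 1) (- m)" using inner[OF t] by blast
    then show ?thesis by (simp add: \<sigma>_def outgoing_slope_eqI)
  qed
  have nbhd: "\<exists>e>0. \<forall>s. \<bar>s - t\<bar> < e \<longrightarrow> k s = k t + of_int (\<sigma> t) * (s - t) \<and> \<sigma> s = \<sigma> t"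
    if t: "t \<in> {0<..<L}" for t
  proof -
    obtain e where e: "0 < e" "\<And>s. \<bar>s - t\<bar> < e \<Longrightarrow> k s = k t + of_int (\<sigma> t) * (s - t)"
      using germ_imp_linear[of k t "\<sigma> t"] \<sigma>[OF t] by blast
    have "\<sigma> s = \<sigma> t" if s: "\<bar>s - t\<bar> < e" for s
      unfolding \<sigma>_def[of s]
    proof (intro outgoing_slope_eqI linear_imp_germ[where e = "e - \<bar>s - t\<bar>"])
      fix u assume "\<bar>u - s\<bar> < e - \<bar>s - t\<bar>"
      then have "\<bar>u - t\<bar> < e" by linarith
      then show "k u = k s + of_int (\<sigma> t) * (u - s)"
        using e(2)[of u] e(2)[OF s] by (simp add: algebra_simps)
    qed (use s in simp)
    with e show ?thesis by blast
  qed
  obtain e where e: "0 < e" "\<And>s. 0 < s \<Longrightarrow> s < e \<Longrightarrow> k s = k 0"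
    using left by (auto simp: germ_def eventually_at_right_field)
  define s0 where "s0 = min e L / 2"
  have s0: "0 < s0" "s0 < e" "s0 < L" using e(1) assms(1) by (auto simp: s0_def min_def)
  have "germ k s0 1 0"
    by (rule linear_imp_germ[where e = "min s0 (e - s0)"]) (use s0 e(2) in \<open>auto simp: abs_if split: if_splits\<close>)
  then have "\<sigma> s0 = 0" by (simp add: \<sigma>_def outgoing_slope_eqI)
  moreover have "\<sigma> t = \<sigma> s0" if "t \<in> {0<..<L}" for t
  proof (rule connected_local_const[of "{0<..<L}" t s0 \<sigma>])
    show "\<forall>a\<in>{0<..<L}. \<forall>\<^sub>F b in at a within {0<..<L}. \<sigma> a = \<sigma> b"
    proof
      fix r assume "r \<in> {0<..<L}"
      from nbhd[OF this] obtain e where "e > 0" "\<And>u. \<bar>u - r\<bar> < e \<Longrightarrow> \<sigma> u = \<sigma> r" by blast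
      then show "\<forall>\<^sub>F u in at r within {0<..<L}. \<sigma> r = \<sigma> u"
        unfolding eventually_at dist_real_def by metis
    qed
  qed (use that s0 in auto)
  ultimately have \<sigma>0: "\<sigma> t = 0" if "t \<in> {0<..<L}" for t using that by simp
  have "k t = k s0" if "t \<in> {0<..<L}" for t
  proof (rule connected_local_const[of "{0<..<L}" t s0 k])
    show "\<forall>a\<in>{0<..<L}. \<forall>\<^sub>F b in at a within {0<..<L}. k a = k b"
    proof
      fix r assume r: "r \<in> {0<..<L}"
      from nbhd[OF this] obtain e where "e > 0" "\<And>u. \<bar>u - r\<bar> < e \<Longrightarrow> k r = k u"
        by (simp add: \<sigma>0[OF r]) metis
      then show "\<forall>\<^sub>F u in at r within {0<..<L}. k r = k u"
        unfolding eventually_at dist_real_def by metis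
    qed
  qed (use that s0 in auto)
  then have const: "k t = k 0" if "t \<in> {0<..<L}" for t
    using that e(2)[of s0] s0 by simp
  obtain e' where e': "0 < e'" "\<And>s. 0 < s \<Longrightarrow> s < e' \<Longrightarrow> k (L - s) = k L + of_int c * s"
    using right by (auto simp: germ_def eventually_at_right_field)
  define u where "u = min e' L / 2"
  have u: "0 < u" "u < e'" "u < L" using e'(1) assms(1) by (auto simp: u_def min_def)
  \<comment> \<open>Equal values at the two distances \<open>u\<close> and \<open>u / 2\<close> from
    \<open>L\<close> force the slope \<open>c\<close> to vanish.\<close>
  have "k 0 = k L + of_int c * u" "k 0 = k L + of_int c * (u / 2)"
    using e'(2)[of u] e'(2)[of "u / 2"] const[of "L - u"] const[of "L - u / 2"] u by auto
  then have c: "of_int c * u = 0" by simp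
  then show "c = 0" using u by simp
  from c have "k L = k 0" using \<open>k 0 = k L + of_int c * u\<close> by simp
  with const show "k t = k 0" if "t \<in> {0..L}"
    using that by (cases "t = 0 \<or> t = L") auto
qed

text \<open>Subtracting the broken line with the same start and the same bends leaves a function
  without bends. The second claim relates the slopes at the two ends of an arc to the degree of the
  divisor inside it.\<close>

lemma broken_line_representation:
  assumes h: "integer_piecewise_linear L h" and L: "0 < L"
    and K: "finite K" "K \<subseteq> {0<..<L}"
    and ord: "\<And>t. t \<in> {0<..<L} \<Longrightarrow>
      outgoing_slope h t 1 + outgoing_slope h t (- 1) = (if t \<in> K then \<delta> t else 0)"
  defines "m \<equiv> outgoing_slope h 0 1"
  shows "t \<in> {0..L} \<Longrightarrow> h t = broken_line (h 0) m \<delta> K t"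
    and "outgoing_slope h L (- 1) = - (m + sum \<delta> K)"
proof -
  let ?R = "broken_line (h 0) m \<delta> K"
  define k where "k t = h t - ?R t" for t
  have inner: "\<exists>m. germ k t 1 m \<and> germ k t (- 1) (- m)" if t: "t \<in> {0<..<L}" for t
  proof -
    have "{s\<in>K. s \<le> t} = (if t \<in> K then insert t {s\<in>K. s < t} else {s\<in>K. s < t})"
      by (auto simp: order_le_less)
    then have "(\<Sum>s\<in>{s\<in>K. s \<le> t}. \<delta> s) = (\<Sum>s\<in>{s\<in>K. s < t}. \<delta> s) + (if t \<in> K then \<delta> t else 0)"
      using K(1) by (simp add: add.commute)
    then have eq: "outgoing_slope h t (- 1) - - (m + (\<Sum>s\<in>{s\<in>K. s < t}. \<delta> s))
        = - (outgoing_slope h t 1 - (m + (\<Sum>s\<in>{s\<in>K. s \<le> t}. \<delta> s)))"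
      using ord[OF t] by simp
    have "germ k t 1 (outgoing_slope h t 1 - (m + (\<Sum>s\<in>{s\<in>K. s \<le> t}. \<delta> s)))"
      unfolding k_def[abs_def] using t
      by (intro germ_diff germ_outgoing_slope[OF h] germ_broken_line K(1)) auto
    moreover have "germ k t (- 1) (outgoing_slope h t (- 1) - - (m + (\<Sum>s\<in>{s\<in>K. s < t}. \<delta> s)))"
      unfolding k_def[abs_def] using t
      by (intro germ_diff germ_outgoing_slope[OF h] germ_broken_line K(1)) auto
    ultimately show ?thesis unfolding eq by blast
  qed
  have "{s\<in>K. s \<le> 0} = {}" "{s\<in>K. s < L} = K" using K(2) by auto
  note empty = this
  have "germ k 0 1 (m - (m + (\<Sum>s\<in>{s\<in>K. s \<le> 0}. \<delta> s)))"
    unfolding k_def[abs_def] m_def using L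
    by (intro germ_diff germ_outgoing_slope[OF h] germ_broken_line K(1)) auto
  then have left: "germ k 0 1 0" by (simp add: empty)
  have "germ k L (- 1) (outgoing_slope h L (- 1) - - (m + (\<Sum>s\<in>{s\<in>K. s < L}. \<delta> s)))"
    unfolding k_def[abs_def] using L
    by (intro germ_diff germ_outgoing_slope[OF h] germ_broken_line K(1)) auto
  note right = this[unfolded empty]
  have "max 0 (- s) = 0" if "s \<in> K" for s using K(2) that by auto
  then have "?R 0 = h 0" by (simp add: broken_line_def)
  then have k0: "k 0 = 0" by (simp add: k_def)
  show "h t = ?R t" if "t \<in> {0..L}"
    using constant_if_germs_cancel(1)[OF L inner left right that] k0 by (simp add: k_def)
  show "outgoing_slope h L (- 1) = - (m + sum \<delta> K)"
    using constant_if_germs_cancel(2)[OF L inner left right] by simp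
qed


section \<open>Weighted degrees\<close>

text \<open>The degree, the number of chips on an initial part of the chain and the class on a cycle
  are all of this form, with integer or real weights.\<close>

definition wsum :: "(('v, 'e) point \<Rightarrow> 'r::comm_ring_1) \<Rightarrow> ('v, 'e) divisor \<Rightarrow> 'r" where
  "wsum w D = (\<Sum>p\<in>Poly_Mapping.keys D. of_int (Poly_Mapping.lookup D p) * w p)"

lemma wsum_superset:
  assumes "finite A" "Poly_Mapping.keys D \<subseteq> A"
  shows "wsum w D = (\<Sum>p\<in>A. of_int (Poly_Mapping.lookup D p) * w p)"
  unfolding wsum_def using assms by (intro sum.mono_neutral_left) (auto simp: in_keys_iff)

lemma wsum_add: "wsum w (D + E) = wsum w D + wsum w E"
proof -
  let ?A = "Poly_Mapping.keys D \<union> Poly_Mapping.keys E"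
  have "Poly_Mapping.keys (D + E) \<subseteq> ?A" by (rule Poly_Mapping.keys_add)
  then show ?thesis
    by (simp add: wsum_superset[of ?A] lookup_add algebra_simps sum.distrib)
qed

lemma wsum_uminus: "wsum w (- D) = - wsum w D"
  by (simp add: wsum_def sum_negf)

lemma wsum_diff: "wsum w (D - E) = wsum w D - wsum w E"
  using wsum_add[of w D "- E"] by (simp add: wsum_uminus)

lemma wsum_0 [simp]: "wsum w 0 = 0"
  by (simp add: wsum_def)

lemma wsum_single [simp]: "wsum w (Poly_Mapping.single p n) = of_int n * w p"
  by (cases "n = 0") (simp_all add: wsum_def)

lemma wsum_sum: "wsum w (\<Sum>i\<in>I. D i) = (\<Sum>i\<in>I. wsum w (D i))"
  by (induction I rule: infinite_finite_induct) (simp_all add: wsum_add)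

lemma wsum_cong: "(\<And>p. p \<in> Poly_Mapping.keys D \<Longrightarrow> w p = w' p) \<Longrightarrow> wsum w D = wsum w' D"
  by (simp add: wsum_def)

lemma wsum_scale: "wsum (\<lambda>p. c * w p) D = c * wsum w D"
  by (simp add: wsum_def sum_distrib_left algebra_simps)

lemma wsum_of_int: "wsum (\<lambda>p. of_int (w p)) D = of_int (wsum w D)"
  by (simp add: wsum_def)

lemma divisor_degree_wsum: "divisor_degree D = wsum (\<lambda>_. 1) D"
  by (simp add: divisor_degree_def wsum_def)

lemma wsum_mono:
  fixes w :: "('v, 'e) point \<Rightarrow> int"
  assumes "effective D" "\<And>p. w p \<le> w' p"
  shows "wsum w D \<le> wsum w' D"
  using assms unfolding wsum_def effective_def by (auto intro!: sum_mono mult_left_mono)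


section \<open>Principal divisors on a chain of cycles\<close>

text \<open>The i-th block is the i-th cycle together with the bridge on its right.\<close>

fun block :: "(chain_vertex, chain_arc) point \<Rightarrow> nat" where
  "block (Vertex (V i)) = i"
| "block (Vertex (W i)) = i"
| "block (Inner (Upper i) t) = i"
| "block (Inner (Lower i) t) = i"
| "block (Inner (Bridge i) t) = i"

definition interior :: "'e \<Rightarrow> ('v, 'e) divisor \<Rightarrow> real set" where
  "interior e D = {t. Inner e t \<in> Poly_Mapping.keys D}"

lemma finite_interior: "finite (interior e D)"
proof -
  have "interior e D = Inner e -` Poly_Mapping.keys D" by (auto simp: interior_def)
  then show ?thesis by (simp add: finite_vimageI inj_on_def)
qed

definition arc_sum :: "(('v, 'e) point \<Rightarrow> 'r::comm_ring_1) \<Rightarrow> 'e \<Rightarrow> ('v, 'e) divisor \<Rightarrow> 'r" where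
  "arc_sum w e D = (\<Sum>t\<in>interior e D. of_int (Poly_Mapping.lookup D (Inner e t)) * w (Inner e t))"

definition block_sum ::
  "((chain_vertex, chain_arc) point \<Rightarrow> 'r::comm_ring_1) \<Rightarrow> nat \<Rightarrow> (chain_vertex, chain_arc) divisor \<Rightarrow> 'r"
where
  "block_sum w j D =
     of_int (Poly_Mapping.lookup D (Vertex (V j))) * w (Vertex (V j)) +
     of_int (Poly_Mapping.lookup D (Vertex (W j))) * w (Vertex (W j)) +
     arc_sum w (Upper j) D + arc_sum w (Lower j) D + arc_sum w (Bridge j) D"

lemma block_sum_const:
  assumes "\<And>p. block p = j \<Longrightarrow> w p = c"
  shows "block_sum w j D = of_int (block_sum (\<lambda>_. 1) j D) * c"
  by (simp add: block_sum_def arc_sum_def assms sum_distrib_right distrib_right)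

lemma block_sum_eq: "block_sum w j D = (\<Sum>p\<in>{p \<in> Poly_Mapping.keys D. block p = j}.
    of_int (Poly_Mapping.lookup D p) * w p)" (is "_ = sum ?h _")
proof -
  let ?v = "{Vertex (V j), Vertex (W j)}"
  let ?i = "\<lambda>e. Inner e ` interior e D"
  let ?X = "?v \<union> ?i (Upper j) \<union> ?i (Lower j) \<union> ?i (Bridge j)"
  have fin: "finite (?i e)" for e by (simp add: finite_interior)
  have arc: "sum ?h (?i e) = arc_sum w e D" for e
    by (simp add: sum.reindex inj_on_def arc_sum_def)
  have "{p \<in> Poly_Mapping.keys D. block p = j} \<subseteq> ?X"
  proof
    fix p assume "p \<in> {p \<in> Poly_Mapping.keys D. block p = j}"
    then show "p \<in> ?X" by (cases p rule: block.cases) (auto simp: interior_def)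
  qed
  then have "sum ?h {p \<in> Poly_Mapping.keys D. block p = j} = sum ?h ?X"
    using fin by (intro sum.mono_neutral_left) (auto simp: interior_def in_keys_iff)
  also have "\<dots> = sum ?h (?v \<union> ?i (Upper j) \<union> ?i (Lower j)) + sum ?h (?i (Bridge j))"
    using fin by (intro sum.union_disjoint) auto
  also have "sum ?h (?v \<union> ?i (Upper j) \<union> ?i (Lower j))
      = sum ?h (?v \<union> ?i (Upper j)) + sum ?h (?i (Lower j))"
    using fin by (intro sum.union_disjoint) auto
  also have "sum ?h (?v \<union> ?i (Upper j)) = sum ?h ?v + sum ?h (?i (Upper j))"
    using fin by (intro sum.union_disjoint) auto
  finally show ?thesis by (simp add: block_sum_def arc)
qed

section \<open>The graph, its blocks and the coordinates on its cycles\<close>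

locale chain =
  fixes g :: nat and a b l :: "nat \<Rightarrow> real"
  assumes g_pos: "1 \<le> g"
    and a_pos: "\<And>i. i \<in> {1..g} \<Longrightarrow> a i > 0"
    and b_pos: "\<And>i. i \<in> {1..g} \<Longrightarrow> b i > 0"
    and l_pos: "\<And>i. i \<in> {1..<g} \<Longrightarrow> l i > 0"
begin

abbreviation \<Gamma> :: "(chain_vertex, chain_arc) metric_graph" where
  "\<Gamma> \<equiv> chain_of_cycles g a b l"

lemma arcs_\<Gamma>: "arcs (model \<Gamma>) = Upper ` {1..g} \<union> Lower ` {1..g} \<union> Bridge ` {1..<g}"
  and tail_\<Gamma>: "tail (model \<Gamma>) = chain_tail"
  and head_\<Gamma>: "head (model \<Gamma>) = chain_head"
  and len_\<Gamma>: "len \<Gamma> (Upper i) = a i" "len \<Gamma> (Lower i) = b i" "len \<Gamma> (Bridge i) = l i"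
  and verts_\<Gamma>: "verts (model \<Gamma>) = V ` {1..g} \<union> W ` {1..g}"
  by (simp_all add: chain_of_cycles_def)

lemma len_pos: "e \<in> arcs (model \<Gamma>) \<Longrightarrow> 0 < len \<Gamma> e"
  using a_pos b_pos l_pos by (auto simp: arcs_\<Gamma> len_\<Gamma>)

lemma arc_simps:
  "Upper i \<in> arcs (model \<Gamma>) \<longleftrightarrow> i \<in> {1..g}"
  "Lower i \<in> arcs (model \<Gamma>) \<longleftrightarrow> i \<in> {1..g}"
  "Bridge i \<in> arcs (model \<Gamma>) \<longleftrightarrow> i \<in> {1..<g}"
  by (auto simp: arcs_\<Gamma>)

lemma points_\<Gamma>:
  "Vertex (V i) \<in> points \<Gamma> \<longleftrightarrow> i \<in> {1..g}"
  "Vertex (W i) \<in> points \<Gamma> \<longleftrightarrow> i \<in> {1..g}"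
  "Inner e t \<in> points \<Gamma> \<longleftrightarrow> e \<in> arcs (model \<Gamma>) \<and> 0 < t \<and> t < len \<Gamma> e"
  by (auto simp: points_def verts_\<Gamma>)

lemma block_points: "p \<in> points \<Gamma> \<Longrightarrow> block p \<in> {1..g}"
  by (cases p rule: block.cases) (auto simp: points_\<Gamma> arcs_\<Gamma>)

lemma tail_arcs:
  "i \<in> {1..g} \<Longrightarrow> {e. e \<in> arcs (model \<Gamma>) \<and> tail (model \<Gamma>) e = V i} = {Upper i, Lower i}"
  "{e. e \<in> arcs (model \<Gamma>) \<and> tail (model \<Gamma>) e = W i} = (if i \<in> {1..<g} then {Bridge i} else {})"
  by (auto simp: arcs_\<Gamma> tail_\<Gamma>)

lemma head_arcs:
  "i \<in> {1..g} \<Longrightarrow> {e. e \<in> arcs (model \<Gamma>) \<and> head (model \<Gamma>) e = W i} = {Upper i, Lower i}"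
  "i \<in> {1..g} \<Longrightarrow> {e. e \<in> arcs (model \<Gamma>) \<and> head (model \<Gamma>) e = V i} =
     (if 1 < i then {Bridge (i - 1)} else {})"
  by (auto simp: arcs_\<Gamma> head_\<Gamma> image_iff)

fun coordinate :: "(chain_vertex, chain_arc) point \<Rightarrow> real" where
  "coordinate (Vertex (V i)) = - a i"
| "coordinate (Vertex (W i)) = 0"
| "coordinate (Inner (Upper i) t) = t - a i"
| "coordinate (Inner (Lower i) t) = b i - t"
| "coordinate (Inner (Bridge i) t) = 0"

text \<open>
  The coordinate, with origin \<open>W i\<close> and modulo the circumference of the \<open>i\<close>-th cycle, of the
  retraction of a point to that cycle.
\<close>

definition \<theta> :: "nat \<Rightarrow> (chain_vertex, chain_arc) point \<Rightarrow> real" where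
  "\<theta> i p = (if block p < i then - a i else if i < block p then 0 else coordinate p)"

definition period :: "nat \<Rightarrow> real \<Rightarrow> bool" where
  "period i x \<longleftrightarrow> (\<exists>k::int. x = of_int k * (a i + b i))"

lemma wsum_blocks:
  assumes "divisor_on \<Gamma> D"
  shows "wsum w D = (\<Sum>j=1..g. block_sum w j D)"
proof -
  have "block ` Poly_Mapping.keys D \<subseteq> {1..g}"
    using assms block_points by (auto simp: divisor_on_def simp del: atLeastAtMost_iff)
  then show ?thesis
    unfolding block_sum_eq wsum_def by (intro sum.group[symmetric]) auto
qed

text \<open>Chips on earlier blocks retract to \<open>V i\<close>, so only their number matters;
  chips on later blocks retract to the origin \<open>W i\<close> and contribute 0.\<close>

lemma wsum_\<theta>:
  assumes "divisor_on \<Gamma> D" "i \<in> {1..g}"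
  shows "wsum (\<theta> i) D = - a i * of_int (\<Sum>j=1..<i. block_sum (\<lambda>_. 1) j D) + block_sum coordinate i D"
proof -
  have "{1..g} = {1..<i} \<union> ({i} \<union> {i<..g})" using assms(2) by auto
  then have "wsum (\<theta> i) D = sum (\<lambda>j. block_sum (\<theta> i) j D) ({1..<i} \<union> ({i} \<union> {i<..g}))"
    by (simp add: wsum_blocks[OF assms(1)])
  also have "\<dots> = (\<Sum>j=1..<i. block_sum (\<theta> i) j D) + (block_sum (\<theta> i) i D + (\<Sum>j\<in>{i<..g}. block_sum (\<theta> i) j D))"
    by (subst sum.union_disjoint; auto)+
  also have "(\<Sum>j\<in>{i<..g}. block_sum (\<theta> i) j D) = 0"
    by (intro sum.neutral ballI) (subst block_sum_const[where c = 0]; simp add: \<theta>_def)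
  also have "(\<Sum>j=1..<i. block_sum (\<theta> i) j D) = (\<Sum>j=1..<i. of_int (block_sum (\<lambda>_. 1) j D) * - a i)"
    by (intro sum.cong refl block_sum_const) (simp add: \<theta>_def)
  also have "block_sum (\<theta> i) i D = block_sum coordinate i D"
    by (simp add: block_sum_def arc_sum_def \<theta>_def)
  finally show ?thesis by (simp add: sum_distrib_left mult.commute)
qed

lemma block_sum_coordinate:
  "block_sum coordinate i D = - a i * of_int (Poly_Mapping.lookup D (Vertex (V i)))
     - (\<Sum>t\<in>interior (Upper i) D. of_int (Poly_Mapping.lookup D (Inner (Upper i) t)) * (a i - t))
     + (\<Sum>t\<in>interior (Lower i) D. of_int (Poly_Mapping.lookup D (Inner (Lower i) t)) * (b i - t))"
proof -
  have "(\<Sum>t\<in>interior (Upper i) D. of_int (Poly_Mapping.lookup D (Inner (Upper i) t)) * (t - a i)) =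
      - (\<Sum>t\<in>interior (Upper i) D. of_int (Poly_Mapping.lookup D (Inner (Upper i) t)) * (a i - t))"
    by (simp add: sum_negf[symmetric] algebra_simps)
  then show ?thesis by (simp add: block_sum_def arc_sum_def)
qed

section \<open>Which divisors are divisors of rational functions\<close>

lemma interior_subset:
  assumes "divisor_on \<Gamma> D"
  shows "interior e D \<subseteq> {0<..<len \<Gamma> e}" and "e \<notin> arcs (model \<Gamma>) \<Longrightarrow> interior e D = {}"
  using assms by (auto simp: interior_def divisor_on_def subset_iff points_\<Gamma>)

lemma lookup_Inner_interior:
  "Poly_Mapping.lookup D (Inner e t) = (if t \<in> interior e D then Poly_Mapping.lookup D (Inner e t) else 0)"
  by (simp add: interior_def in_keys_iff)

text \<open>Here \<open>s e\<close> is the slope at the start of an arc and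
  \<open>\<Delta> e\<close> the total bend along it, so the function arrives at the head with slope
  \<open>s e + \<Delta> e\<close>.\<close>

lemma ord_vertex:
  assumes i: "i \<in> {1..g}"
    and start: "\<And>e. e \<in> arcs (model \<Gamma>) \<Longrightarrow> outgoing_slope (\<lambda>t. f (arc_point \<Gamma> e t)) 0 1 = s e"
    and stop: "\<And>e. e \<in> arcs (model \<Gamma>) \<Longrightarrow>
      outgoing_slope (\<lambda>t. f (arc_point \<Gamma> e t)) (len \<Gamma> e) (- 1) = - (s e + \<Delta> e)"
  shows "ord_at \<Gamma> f (Vertex (V i)) = s (Upper i) + s (Lower i) -
      (if 1 < i then s (Bridge (i - 1)) + \<Delta> (Bridge (i - 1)) else 0)"
    and "ord_at \<Gamma> f (Vertex (W i)) = (if i < g then s (Bridge i) else 0) -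
      (s (Upper i) + \<Delta> (Upper i)) - (s (Lower i) + \<Delta> (Lower i))"
proof -
  have "i - 1 \<in> {1..<g}" if "1 < i" using i that by auto
  then show "ord_at \<Gamma> f (Vertex (V i)) = s (Upper i) + s (Lower i) -
      (if 1 < i then s (Bridge (i - 1)) + \<Delta> (Bridge (i - 1)) else 0)"
    using i by (simp add: tail_arcs head_arcs start stop arc_simps)
  show "ord_at \<Gamma> f (Vertex (W i)) = (if i < g then s (Bridge i) else 0) -
      (s (Upper i) + \<Delta> (Upper i)) - (s (Lower i) + \<Delta> (Lower i))"
    using i by (simp add: tail_arcs head_arcs start stop arc_simps)
qed

text \<open>A bridge separates the chain, so the slope at its far end must be the degree of
  \<open>D\<close> on the blocks up to it. On a cycle both arcs have the same total rise; after
  eliminating the upper slope through the coefficient at \<open>V i\<close>, this says that the sum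
  of coordinates is minus the initial slope of \<open>Lower i\<close> times the
  circumference.\<close>

lemma principal_imp:
  assumes D: "divisor_on \<Gamma> D"
    and f: "rational_function \<Gamma> f" "\<And>p. p \<in> points \<Gamma> \<Longrightarrow> Poly_Mapping.lookup D p = ord_at \<Gamma> f p"
  shows "divisor_degree D = 0" and "i \<in> {1..g} \<Longrightarrow> period i (wsum (\<theta> i) D)"
proof -
  let ?h = "\<lambda>e t. f (arc_point \<Gamma> e t)"
  let ?\<delta> = "\<lambda>e t. Poly_Mapping.lookup D (Inner e t)"
  define s where "s e = outgoing_slope (?h e) 0 1" for e
  define \<Delta> where "\<Delta> e = sum (?\<delta> e) (interior e D)" for e
  have rep: "\<And>t. t \<in> {0..len \<Gamma> e} \<Longrightarrow> ?h e t = broken_line (?h e 0) (s e) (?\<delta> e) (interior e D) t"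
    and stop: "outgoing_slope (?h e) (len \<Gamma> e) (- 1) = - (s e + \<Delta> e)"
    if e: "e \<in> arcs (model \<Gamma>)" for e
  proof -
    have 1: "integer_piecewise_linear (len \<Gamma> e) (?h e)"
      using f(1) e by (simp add: rational_function_def)
    have 2: "outgoing_slope (?h e) t 1 + outgoing_slope (?h e) t (- 1) =
        (if t \<in> interior e D then ?\<delta> e t else 0)" if "t \<in> {0<..<len \<Gamma> e}" for t
      using f(2)[of "Inner e t"] e that lookup_Inner_interior[of D e t] by (simp add: points_\<Gamma>)
    note * = broken_line_representation[OF 1 len_pos[OF e] finite_interior interior_subset(1)[OF D] 2]
    show "?h e t = broken_line (?h e 0) (s e) (?\<delta> e) (interior e D) t" if "t \<in> {0..len \<Gamma> e}" for t
      using *(1)[OF _ that] by (simp add: s_def)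
    show "outgoing_slope (?h e) (len \<Gamma> e) (- 1) = - (s e + \<Delta> e)"
      using *(2) by (simp add: s_def \<Delta>_def)
  qed
  have total: "?h e (len \<Gamma> e) = ?h e 0 + of_int (s e) * len \<Gamma> e
      + (\<Sum>t\<in>interior e D. of_int (?\<delta> e t) * (len \<Gamma> e - t))" if e: "e \<in> arcs (model \<Gamma>)" for e
  proof -
    have "max 0 (len \<Gamma> e - t) = len \<Gamma> e - t" if "t \<in> interior e D" for t
      using interior_subset(1)[OF D] that by fastforce
    then show ?thesis
      using rep[OF e, of "len \<Gamma> e"] len_pos[OF e] by (simp add: broken_line_def)
  qed
  note vertex = ord_vertex[OF _ s_def[symmetric] stop]
  define c where "c i = (if 1 \<le> i \<and> i < g then s (Bridge i) + \<Delta> (Bridge i) else 0)" for i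
  have \<Delta>g: "\<Delta> (Bridge g) = 0"
    by (simp add: \<Delta>_def interior_subset(2)[OF D] arc_simps)
  have V: "Poly_Mapping.lookup D (Vertex (V i)) = s (Upper i) + s (Lower i) - c (i - 1)"
    if i: "i \<in> {1..g}" for i
    using f(2)[of "Vertex (V i)"] vertex(1)[OF i] i by (auto simp: points_\<Gamma> c_def)
  have W: "Poly_Mapping.lookup D (Vertex (W i)) = (if i < g then s (Bridge i) else 0) -
      (s (Upper i) + \<Delta> (Upper i)) - (s (Lower i) + \<Delta> (Lower i))"
    if i: "i \<in> {1..g}" for i
    using f(2)[of "Vertex (W i)"] vertex(2)[OF i] i by (simp add: points_\<Gamma>)
  have block1: "block_sum (\<lambda>_. 1) i D = c i - c (i - 1)" if i: "i \<in> {1..g}" for i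
  proof -
    have "block_sum (\<lambda>_. 1) i D = Poly_Mapping.lookup D (Vertex (V i)) + Poly_Mapping.lookup D (Vertex (W i))
        + \<Delta> (Upper i) + \<Delta> (Lower i) + \<Delta> (Bridge i)"
      by (simp add: block_sum_def arc_sum_def \<Delta>_def)
    also have "\<dots> = (if i < g then s (Bridge i) else 0) + \<Delta> (Bridge i) - c (i - 1)"
      unfolding V[OF i] W[OF i] by simp
    also have "(if i < g then s (Bridge i) else 0) + \<Delta> (Bridge i) = c i"
      using i \<Delta>g by (cases "i = g") (auto simp: c_def)
    finally show ?thesis .
  qed
  have cum: "(\<Sum>j=1..k. block_sum (\<lambda>_. 1) j D) = c k" if "k \<le> g" for k
    using that by (induction k) (simp_all add: block1 c_def)
  show "divisor_degree D = 0"
    using cum[of g] by (simp add: divisor_degree_wsum wsum_blocks[OF D] c_def)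
  show "period i (wsum (\<theta> i) D)" if i: "i \<in> {1..g}"
  proof -
    have "{1..<i} = {1..i - 1}" using i by auto
    then have cum': "(\<Sum>j=1..<i. block_sum (\<lambda>_. 1) j D) = c (i - 1)"
      using cum[of "i - 1"] i by auto
    have "?h (Upper i) 0 = ?h (Lower i) 0" "?h (Upper i) (a i) = ?h (Lower i) (b i)"
      using a_pos[OF i] b_pos[OF i] by (simp_all add: arc_point_def tail_\<Gamma> head_\<Gamma> len_\<Gamma>)
    then have "of_int (s (Upper i)) * a i + (\<Sum>t\<in>interior (Upper i) D. of_int (?\<delta> (Upper i) t) * (a i - t))
      = of_int (s (Lower i)) * b i + (\<Sum>t\<in>interior (Lower i) D. of_int (?\<delta> (Lower i) t) * (b i - t))"
      using total[of "Upper i"] total[of "Lower i"] i by (simp add: arc_simps len_\<Gamma>)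
    then have "wsum (\<theta> i) D = of_int (- s (Lower i)) * (a i + b i)"
      unfolding wsum_\<theta>[OF D i] cum' block_sum_coordinate V[OF i] by (simp add: algebra_simps)
    then show ?thesis unfolding period_def by blast
  qed
qed

lemma imp_principal:
  assumes D: "divisor_on \<Gamma> D" and deg: "divisor_degree D = 0"
    and per: "\<And>i. i \<in> {1..g} \<Longrightarrow> period i (wsum (\<theta> i) D)"
  shows "\<exists>f. rational_function \<Gamma> f \<and> (\<forall>p\<in>points \<Gamma>. Poly_Mapping.lookup D p = ord_at \<Gamma> f p)"
proof -
  let ?\<delta> = "\<lambda>e t. Poly_Mapping.lookup D (Inner e t)"
  define \<Delta> where "\<Delta> e = sum (?\<delta> e) (interior e D)" for e
  define c :: "nat \<Rightarrow> int" where "c i = (\<Sum>j=1..i. block_sum (\<lambda>_. 1) j D)" for i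
  obtain z :: "nat \<Rightarrow> int" where z: "\<And>i. i \<in> {1..g} \<Longrightarrow> wsum (\<theta> i) D = of_int (z i) * (a i + b i)"
    using per unfolding period_def by metis
  \<comment> \<open>The slope \<open>c (i - 1)\<close> arrives at \<open>V i\<close>, and
    \<open>z i\<close> decides how the outgoing slope is split between the two arcs;
    \<open>- z i\<close> on the lower arc is the value found in \<open>principal_imp\<close>. A
    bridge starts with the slope that makes it arrive with \<open>c i\<close>.\<close>
  define s where "s e = (case e of
      Upper i \<Rightarrow> Poly_Mapping.lookup D (Vertex (V i)) + c (i - 1) + z i
    | Lower i \<Rightarrow> - z i
    | Bridge i \<Rightarrow> c i - \<Delta> (Bridge i))" for e
  define rise where "rise e = of_int (s e) * len \<Gamma> e
      + (\<Sum>t\<in>interior e D. of_int (?\<delta> e t) * (len \<Gamma> e - t))" for e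
  \<comment> \<open>Values at the vertices, integrated along upper arcs and bridges. That the lower
    arcs fit is the content of \<open>cycle\<close>, where the period condition enters.\<close>
  define pot where "pot v = (case v of
      V i \<Rightarrow> \<Sum>j=1..<i. rise (Upper j) + rise (Bridge j)
    | W i \<Rightarrow> (\<Sum>j=1..<i. rise (Upper j) + rise (Bridge j)) + rise (Upper i))" for v
  define R where "R e = broken_line (pot (chain_tail e)) (s e) (?\<delta> e) (interior e D)" for e
  define f where "f p = (case p of Vertex v \<Rightarrow> pot v | Inner e t \<Rightarrow> R e t)" for p
  have cycle: "rise (Upper i) = rise (Lower i)" if i: "i \<in> {1..g}" for i
  proof -
    have "{1..<i} = {1..i - 1}" using i by auto
    then have "(\<Sum>j=1..<i. block_sum (\<lambda>_. 1) j D) = c (i - 1)" by (simp add: c_def)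
    then show ?thesis
      using z[OF i] unfolding wsum_\<theta>[OF D i] block_sum_coordinate
      by (simp add: rise_def s_def len_\<Gamma> algebra_simps)
  qed
  have head: "pot (chain_head e) = pot (chain_tail e) + rise e" if e: "e \<in> arcs (model \<Gamma>)" for e
    using e by (auto simp: arcs_\<Gamma> pot_def cycle)
  have hR: "f (arc_point \<Gamma> e t) = R e t" if e: "e \<in> arcs (model \<Gamma>)" and t: "t \<in> {0..len \<Gamma> e}" for e t
  proof -
    have "max 0 (len \<Gamma> e - t) = len \<Gamma> e - t" if "t \<in> interior e D" for t
      using interior_subset(1)[OF D] that by fastforce
    then have stop: "R e (len \<Gamma> e) = pot (chain_head e)"
      by (simp add: R_def broken_line_def head[OF e] rise_def)
    have "max 0 (- t) = 0" if "t \<in> interior e D" for t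
      using interior_subset(1)[OF D] that by fastforce
    then have "R e 0 = pot (chain_tail e)" by (simp add: R_def broken_line_def)
    with stop t show ?thesis
      by (cases "t = 0"; cases "t = len \<Gamma> e") (auto simp: arc_point_def f_def tail_\<Gamma> head_\<Gamma>)
  qed
  have slope: "outgoing_slope (\<lambda>t. f (arc_point \<Gamma> e t)) t 1 = s e + (\<Sum>u\<in>{u\<in>interior e D. u \<le> t}. ?\<delta> e u)"
    if e: "e \<in> arcs (model \<Gamma>)" and t: "0 \<le> t" "t < len \<Gamma> e" for e t
  proof (rule outgoing_slope_eqI)
    show "germ (\<lambda>t. f (arc_point \<Gamma> e t)) t 1 (s e + (\<Sum>u\<in>{u\<in>interior e D. u \<le> t}. ?\<delta> e u))"
      using germ_broken_line(1)[OF finite_interior] t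
      by (subst germ_cong[OF hR[OF e], of "len \<Gamma> e"]) (auto simp: R_def)
  qed
  have slope': "outgoing_slope (\<lambda>t. f (arc_point \<Gamma> e t)) t (- 1) =
      - (s e + (\<Sum>u\<in>{u\<in>interior e D. u < t}. ?\<delta> e u))"
    if e: "e \<in> arcs (model \<Gamma>)" and t: "0 < t" "t \<le> len \<Gamma> e" for e t
  proof (rule outgoing_slope_eqI)
    show "germ (\<lambda>t. f (arc_point \<Gamma> e t)) t (- 1) (- (s e + (\<Sum>u\<in>{u\<in>interior e D. u < t}. ?\<delta> e u)))"
      using germ_broken_line(2)[OF finite_interior] t
      by (subst germ_cong[OF hR[OF e], of "len \<Gamma> e"]) (auto simp: R_def)
  qed
  have rat: "rational_function \<Gamma> f"
    unfolding rational_function_def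
  proof
    fix e assume "e \<in> arcs (model \<Gamma>)"
    then show "integer_piecewise_linear (len \<Gamma> e) (\<lambda>t. f (arc_point \<Gamma> e t))"
      using hR by (rule_tac integer_piecewise_linear_cong[where k = "R e"])
        (auto simp: R_def intro: integer_piecewise_linear_broken_line finite_interior)
  qed
  have empty: "{u \<in> interior e D. u \<le> 0} = {}"
    and full: "{u \<in> interior e D. u < len \<Gamma> e} = interior e D" for e
    using interior_subset(1)[OF D, of e] by force+
  have start: "outgoing_slope (\<lambda>t. f (arc_point \<Gamma> e t)) 0 1 = s e"
      and stop: "outgoing_slope (\<lambda>t. f (arc_point \<Gamma> e t)) (len \<Gamma> e) (- 1) = - (s e + \<Delta> e)"
    if "e \<in> arcs (model \<Gamma>)" for e
    using slope[OF that, of 0, unfolded empty] slope'[OF that, of "len \<Gamma> e"] len_pos[OF that]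
    by (simp_all add: \<Delta>_def full)
  have c0: "c 0 = 0" by (simp add: c_def)
  \<comment> \<open>Degree 0 closes the balance at \<open>W g\<close>, where no bridge leads any
    slope away.\<close>
  have cg: "c g = 0" using deg by (simp add: divisor_degree_wsum wsum_blocks[OF D] c_def)
  have cS: "c i = c (i - 1) + Poly_Mapping.lookup D (Vertex (V i)) + Poly_Mapping.lookup D (Vertex (W i))
        + \<Delta> (Upper i) + \<Delta> (Lower i) + \<Delta> (Bridge i)" if i: "i \<in> {1..g}" for i
  proof -
    obtain k where k: "i = Suc k" using i by (cases i) auto
    show ?thesis unfolding k by (simp add: c_def block_sum_def arc_sum_def \<Delta>_def)
  qed
  have \<Delta>g: "\<Delta> (Bridge g) = 0"
    by (simp add: \<Delta>_def interior_subset(2)[OF D] arc_simps)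
  have "Poly_Mapping.lookup D p = ord_at \<Gamma> f p" if p: "p \<in> points \<Gamma>" for p
  proof (cases p)
    case (Inner e t)
    with p have e: "e \<in> arcs (model \<Gamma>)" "0 < t" "t < len \<Gamma> e" by (auto simp: points_\<Gamma>)
    have "{u\<in>interior e D. u \<le> t} =
        (if t \<in> interior e D then insert t {u\<in>interior e D. u < t} else {u\<in>interior e D. u < t})"
      by (auto simp: order_le_less)
    then have "(\<Sum>u\<in>{u\<in>interior e D. u \<le> t}. ?\<delta> e u) =
        (\<Sum>u\<in>{u\<in>interior e D. u < t}. ?\<delta> e u) + (if t \<in> interior e D then ?\<delta> e t else 0)"
      using finite_interior[of e D] by (simp add: add.commute)
    then show ?thesis
      using slope[OF e(1), of t] slope'[OF e(1), of t] e Inner lookup_Inner_interior[of D e t] by simp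
  next
    case (Vertex v)
    show ?thesis
    proof (cases v)
      case (V i)
      with Vertex p have i: "i \<in> {1..g}" by (simp add: points_\<Gamma>)
      have "c (i - 1) = 0" if "\<not> 1 < i" using that c0 by simp
      then show ?thesis
        unfolding Vertex V using ord_vertex(1)[of i f s \<Delta>, OF i start stop]
        by (auto simp: s_def simp del: ord_at.simps)
    next
      case (W i)
      with Vertex p have i: "i \<in> {1..g}" by (simp add: points_\<Gamma>)
      show ?thesis
        unfolding Vertex W using ord_vertex(2)[of i f s \<Delta>, OF i start stop] cS[OF i] i \<Delta>g cg
        by (cases "i = g") (auto simp: s_def simp del: ord_at.simps)
    qed
  qed
  with rat show ?thesis by blast
qed

lemma divisor_on_diff: "divisor_on \<Gamma> D \<Longrightarrow> divisor_on \<Gamma> E \<Longrightarrow> divisor_on \<Gamma> (D - E)"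
  using keys_diff[of D E] by (auto simp: divisor_on_def)

lemma linearly_equivalent_iff:
  assumes "divisor_on \<Gamma> D" "divisor_on \<Gamma> E"
  shows "linearly_equivalent \<Gamma> D E \<longleftrightarrow>
    divisor_degree D = divisor_degree E \<and> (\<forall>i\<in>{1..g}. period i (wsum (\<theta> i) D - wsum (\<theta> i) E))"
proof
  assume "linearly_equivalent \<Gamma> D E"
  then obtain f where f: "rational_function \<Gamma> f"
      "\<And>p. p \<in> points \<Gamma> \<Longrightarrow> Poly_Mapping.lookup (D - E) p = ord_at \<Gamma> f p"
    unfolding linearly_equivalent_def by blast
  from principal_imp[OF divisor_on_diff[OF assms] f]
  show "divisor_degree D = divisor_degree E \<and> (\<forall>i\<in>{1..g}. period i (wsum (\<theta> i) D - wsum (\<theta> i) E))"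
    by (simp add: divisor_degree_wsum wsum_diff)
next
  assume *: "divisor_degree D = divisor_degree E \<and> (\<forall>i\<in>{1..g}. period i (wsum (\<theta> i) D - wsum (\<theta> i) E))"
  show "linearly_equivalent \<Gamma> D E"
    unfolding linearly_equivalent_def
    by (rule imp_principal[OF divisor_on_diff[OF assms]])
      (use * in \<open>auto simp: divisor_degree_wsum wsum_diff\<close>)
qed


section \<open>Rank\<close>

lemma period_0 [simp]: "period i 0"
  unfolding period_def by (intro exI[of _ 0]) simp

lemma period_add: "period i x \<Longrightarrow> period i y \<Longrightarrow> period i (x + y)"
  unfolding period_def by (metis distrib_right of_int_add)

lemma period_uminus: "period i x \<Longrightarrow> period i (- x)"
  unfolding period_def by (metis mult_minus_left of_int_minus)

lemma period_diff: "period i x \<Longrightarrow> period i y \<Longrightarrow> period i (x - y)"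
  using period_add[of i x "- y"] period_uminus[of i y] by simp

text \<open>The marked points of a cycle are distinct: 0 < \<open>a i\<close> <
  \<open>a i + b i\<close>.\<close>

lemma not_period_a:
  assumes i: "i \<in> {1..g}"
  shows "\<not> period i (a i)"
proof
  assume "period i (a i)"
  then obtain k :: int where k: "a i = of_int k * (a i + b i)" by (auto simp: period_def)
  have "0 < k" using k a_pos[OF i] b_pos[OF i]
    by (metis add_pos_pos of_int_0_less_iff zero_less_mult_pos2)
  then have "1 * (a i + b i) \<le> of_int k * (a i + b i)"
    using a_pos[OF i] b_pos[OF i] by (intro mult_right_mono) auto
  with k b_pos[OF i] show False by simp
qed

text \<open>The multiples of the torsion order of the cycle, and 0 alone if
  \<open>a i / (a i + b i)\<close> is irrational. This is the relation put for \<open>T\<close> in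
  the tableaux.\<close>

definition torsion :: "nat \<Rightarrow> int \<Rightarrow> bool" where
  "torsion i z \<longleftrightarrow> period i (a i * of_int z)"

lemma torsion_0: "torsion i 0"
  by (simp add: torsion_def)

lemma torsion_uminus: "torsion i z \<Longrightarrow> torsion i (- z)"
  using period_uminus[of i "a i * of_int z"] by (simp add: torsion_def)

definition rank_at_least :: "(chain_vertex, chain_arc) divisor \<Rightarrow> nat \<Rightarrow> bool" where
  "rank_at_least D n \<longleftrightarrow>
     (\<forall>E. divisor_on \<Gamma> E \<and> effective E \<and> divisor_degree E = int n \<longrightarrow>
        (\<exists>D'. divisor_on \<Gamma> D' \<and> effective D' \<and> linearly_equivalent \<Gamma> D D' \<and> effective (D' - E)))"

lemma divisor_on_add: "divisor_on \<Gamma> D \<Longrightarrow> divisor_on \<Gamma> E \<Longrightarrow> divisor_on \<Gamma> (D + E)"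
  using Poly_Mapping.keys_add[of D E] by (auto simp: divisor_on_def)

lemma divisor_on_single: "p \<in> points \<Gamma> \<Longrightarrow> divisor_on \<Gamma> (Poly_Mapping.single p n)"
  by (simp add: divisor_on_def)

lemma divisor_on_0: "divisor_on \<Gamma> 0"
  by (simp add: divisor_on_def)

lemma divisor_on_sum: "(\<And>i. i \<in> I \<Longrightarrow> divisor_on \<Gamma> (D i)) \<Longrightarrow> divisor_on \<Gamma> (\<Sum>i\<in>I. D i)"
  by (induction I rule: infinite_finite_induct) (auto intro: divisor_on_add simp: divisor_on_0)

lemma effective_add: "effective D \<Longrightarrow> effective E \<Longrightarrow> effective (D + E)"
  by (simp add: effective_def lookup_add)

lemma effective_single: "0 \<le> n \<Longrightarrow> effective (Poly_Mapping.single p n)"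
  by (simp add: effective_def lookup_single when_def)

lemma effective_0: "effective 0"
  by (simp add: effective_def)

lemma effective_sum: "(\<And>i. i \<in> I \<Longrightarrow> effective (D i)) \<Longrightarrow> effective (\<Sum>i\<in>I. D i)"
  by (induction I rule: infinite_finite_induct) (auto intro: effective_add simp: effective_0)


section \<open>From rank to tableaux\<close>

definition degree_upto :: "nat \<Rightarrow> (chain_vertex, chain_arc) divisor \<Rightarrow> int" where
  "degree_upto i F = wsum (\<lambda>p. of_bool (block p \<le> i)) F"

lemma degree_upto_mono: "effective F \<Longrightarrow> i \<le> j \<Longrightarrow> degree_upto i F \<le> degree_upto j F"
  unfolding degree_upto_def by (intro wsum_mono) auto

lemma degree_upto_nonneg: "effective F \<Longrightarrow> 0 \<le> degree_upto i F"
  unfolding degree_upto_def wsum_def effective_def by (intro sum_nonneg) auto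

lemma degree_upto_all: "divisor_on \<Gamma> F \<Longrightarrow> degree_upto g F = divisor_degree F"
  unfolding degree_upto_def divisor_degree_wsum
  using block_points by (intro wsum_cong) (fastforce simp: divisor_on_def)

text \<open>Passing a cycle without leaving a chip on it forces the class there: the chips so far
  all count as \<open>V\<close>, the later ones as the origin.\<close>

lemma wsum_\<theta>_empty_block:
  assumes "effective F" "degree_upto (Suc i) F = degree_upto i F"
  shows "wsum (\<theta> (Suc i)) F = - a (Suc i) * of_int (degree_upto i F)"
proof -
  have "(\<Sum>p\<in>Poly_Mapping.keys F. Poly_Mapping.lookup F p * of_bool (block p = Suc i)) =
      degree_upto (Suc i) F - degree_upto i F"
    unfolding degree_upto_def wsum_def sum_subtractf[symmetric]
    by (intro sum.cong) (auto simp: le_Suc_eq)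
  then have "\<forall>p\<in>Poly_Mapping.keys F. Poly_Mapping.lookup F p * of_bool (block p = Suc i) = 0"
    using assms sum_nonneg_eq_0_iff[of "Poly_Mapping.keys F"
        "\<lambda>p. Poly_Mapping.lookup F p * of_bool (block p = Suc i)"]
    by (simp add: effective_def)
  then have "block p \<noteq> Suc i" if "p \<in> Poly_Mapping.keys F" for p
    using that by (auto simp: in_keys_iff)
  then have "wsum (\<theta> (Suc i)) F = wsum (\<lambda>p. - a (Suc i) * of_int (of_bool (block p \<le> i))) F"
    by (intro wsum_cong) (force simp: \<theta>_def)
  then show ?thesis by (simp only: wsum_scale wsum_of_int degree_upto_def)
qed

text \<open>A position \<open>x\<close> is the number of cycles passed minus the number of chips on
  them, those of the subtracted divisor included. With \<open>i - 1\<close> cycles passed there are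
  \<open>i - 1 - x\<close> such chips, and an empty i-th block gives the class - \<open>a i\<close>
  * (\<open>i - 1 - x\<close>).\<close>

definition hit :: "(chain_vertex, chain_arc) divisor \<Rightarrow> nat \<Rightarrow> int \<Rightarrow> bool" where
  "hit D i x \<longleftrightarrow> period i (wsum (\<theta> i) D - a i * of_int (x - int i + 1))"

text \<open>
  The positions of particles that never collide. In the \<open>i\<close>-th step a particle at \<open>x\<close> moves up by
  one if an effective divisor can carry the corresponding number of chips through the \<open>i\<close>-th cycle
  without leaving one behind.
\<close>

primrec pos :: "(chain_vertex, chain_arc) divisor \<Rightarrow> nat \<Rightarrow> nat \<Rightarrow> int" where
  "pos D 0 = (\<lambda>j. - int j)"
| "pos D (Suc i) = (\<lambda>j. pos D i j +
     of_bool (hit D (Suc i) (pos D i j) \<and> (j = 0 \<or> pos D i j + 1 < pos D i (j - 1))))"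

lemma pos_less: "pos D i (Suc j) < pos D i j"
proof (induction i)
  case (Suc i)
  have "pos D i (Suc j) + 1 \<le> pos D i j" using Suc by simp
  then show ?case by auto
qed simp

lemma pos_le: "pos D i j \<le> int i - int j"
  by (induction i) auto

lemma pos_descend: "j \<le> r \<Longrightarrow> pos D i r + int (r - j) \<le> pos D i j"
proof (induction r)
  case (Suc r)
  then show ?case using pos_less[of D i r] by (cases "j = Suc r") (auto simp: Suc_diff_le)
qed simp

text \<open>To every cycle beyond \<open>i\<close>, \<open>E\<close> looks like \<open>j\<close>
  chips on its left. Since \<open>F\<close> is constrained only on the first \<open>i\<close>
  cycles, \<open>E\<close> can be built step by step along the chain.\<close>

definition forces :: "(chain_vertex, chain_arc) divisor \<Rightarrow> nat \<Rightarrow> nat \<Rightarrow> (chain_vertex, chain_arc) divisor \<Rightarrow> bool"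
  where
  "forces D i j E \<longleftrightarrow> divisor_on \<Gamma> E \<and> effective E \<and> divisor_degree E = int j \<and>
     (\<forall>i'\<in>{1..g}. i < i' \<longrightarrow> wsum (\<theta> i') E = - a i' * of_int j) \<and>
     (\<forall>F. divisor_on \<Gamma> F \<and> effective F \<and>
        (\<forall>i'\<in>{1..i}. period i' (wsum (\<theta> i') D - wsum (\<theta> i') E - wsum (\<theta> i') F)) \<longrightarrow>
        int i - int j - pos D i j \<le> degree_upto i F)"

text \<open>
  A particle that would move but is blocked by its neighbour is dealt with by placing an additional
  chip at \<open>W (Suc i)\<close> in the divisor forcing the bound for that neighbour.
\<close>

lemma forces_exists: "i \<le> g \<Longrightarrow> \<exists>E. forces D i j E"
proof (induction i arbitrary: j)
  case 0
  let ?E = "Poly_Mapping.single (Vertex (V 1)) (int j)"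
  have "\<theta> i' (Vertex (V 1)) = - a i'" if "i' \<in> {1..g}" for i'
    using that by (cases "i' = 1") (auto simp: \<theta>_def)
  then have "forces D 0 j ?E"
    using g_pos by (auto simp: forces_def divisor_on_single effective_single points_\<Gamma>
        divisor_degree_wsum degree_upto_nonneg)
  then show ?case by blast
next
  case (Suc i)
  let ?x = "pos D i j"
  have S: "Suc i \<in> {1..g}" using Suc.prems by simp
  \<comment> \<open>If \<open>F\<close> meets the bound on the first \<open>i\<close> blocks with
    equality and leaves block \<open>Suc i\<close> empty, its class there is determined. Where
    \<open>D\<close> excludes that class, one more chip is needed. The term \<open>y\<close> is
    minus the contribution of \<open>E\<close>.\<close>
  have *: "int i - int j - ?x < degree_upto (Suc i) F"
    if F: "effective F" "int i - int j - ?x \<le> degree_upto i F"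
      and per: "period (Suc i) (wsum (\<theta> (Suc i)) D + y - wsum (\<theta> (Suc i)) F)"
      and no: "\<not> period (Suc i) (wsum (\<theta> (Suc i)) D + y + a (Suc i) * of_int (int i - int j - ?x))"
    for F y
  proof (rule ccontr)
    assume "\<not> ?thesis"
    with F degree_upto_mono[OF F(1), of i "Suc i"]
    have eq: "degree_upto i F = int i - int j - ?x" "degree_upto (Suc i) F = degree_upto i F" by auto
    from per no show False
      unfolding wsum_\<theta>_empty_block[OF F(1) eq(2)] eq(1) by simp
  qed
  consider (stay) "\<not> hit D (Suc i) ?x"
    | (blocked) "hit D (Suc i) ?x" "j \<noteq> 0" "\<not> ?x + 1 < pos D i (j - 1)"
    | (move) "hit D (Suc i) ?x" "j = 0 \<or> ?x + 1 < pos D i (j - 1)"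
    by (cases "hit D (Suc i) ?x"; cases "j = 0 \<or> ?x + 1 < pos D i (j - 1)") auto
  then show ?case
  proof cases
    case stay
    obtain E where E: "forces D i j E" using Suc by fastforce
    have "int (Suc i) - int j - pos D (Suc i) j \<le> degree_upto (Suc i) F"
      if F: "divisor_on \<Gamma> F" "effective F"
        and per: "\<forall>i'\<in>{1..Suc i}. period i' (wsum (\<theta> i') D - wsum (\<theta> i') E - wsum (\<theta> i') F)" for F
    proof -
      have "int i - int j - ?x \<le> degree_upto i F"
        using E F per by (auto simp: forces_def)
      moreover have "wsum (\<theta> (Suc i)) E = - a (Suc i) * of_int j"
        using E S by (simp add: forces_def)
      then have "period (Suc i) (wsum (\<theta> (Suc i)) D + a (Suc i) * of_int j - wsum (\<theta> (Suc i)) F)"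
        using bspec[OF per, of "Suc i"] by simp
      moreover have "wsum (\<theta> (Suc i)) D + a (Suc i) * of_int j + a (Suc i) * of_int (int i - int j - ?x)
          = wsum (\<theta> (Suc i)) D - a (Suc i) * of_int (?x - int (Suc i) + 1)"
        by (simp add: algebra_simps)
      then have "\<not> period (Suc i) (wsum (\<theta> (Suc i)) D + a (Suc i) * of_int j
          + a (Suc i) * of_int (int i - int j - ?x))"
        using stay by (simp only: hit_def not_False_eq_True)
      ultimately have "int i - int j - ?x < degree_upto (Suc i) F" by (rule *[OF F(2)])
      with stay show ?thesis by simp
    qed
    then have "forces D (Suc i) j E" using E by (auto simp: forces_def)
    then show ?thesis by blast
  next
    case blocked
    obtain k where k: "j = Suc k" using blocked(2) by (cases j) auto
    have nb: "pos D i k = ?x + 1"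
      using blocked(3) pos_less[of D i k] by (simp add: k)
    \<comment> \<open>The neighbour has one chip fewer and stands one position higher, so its
      divisor forces the same bound \<open>i - j - ?x\<close>. It remains to gain one chip on block
      \<open>Suc i\<close>.\<close>
    obtain E where E: "forces D i k E" using Suc by fastforce
    let ?E = "E + Poly_Mapping.single (Vertex (W (Suc i))) 1"
    have \<theta>E: "wsum (\<theta> i') ?E = wsum (\<theta> i') E + (if Suc i < i' then - a i' else 0)" for i'
      by (simp add: wsum_add \<theta>_def)
    have "int (Suc i) - int j - pos D (Suc i) j \<le> degree_upto (Suc i) F"
      if F: "divisor_on \<Gamma> F" "effective F"
        and per: "\<forall>i'\<in>{1..Suc i}. period i' (wsum (\<theta> i') D - wsum (\<theta> i') ?E - wsum (\<theta> i') F)" for F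
    proof -
      have "\<forall>i'\<in>{1..i}. period i' (wsum (\<theta> i') D - wsum (\<theta> i') E - wsum (\<theta> i') F)"
        using per by (auto simp: \<theta>E)
      then have "int i - int k - pos D i k \<le> degree_upto i F"
        using E F unfolding forces_def by blast
      then have "int i - int j - ?x \<le> degree_upto i F" by (simp add: nb k)
      moreover have "wsum (\<theta> (Suc i)) E = - a (Suc i) * of_int k"
        using E S by (simp add: forces_def)
      then have "period (Suc i) (wsum (\<theta> (Suc i)) D + a (Suc i) * of_int k - wsum (\<theta> (Suc i)) F)"
        using bspec[OF per, of "Suc i"] by (simp add: \<theta>E)
      \<comment> \<open>The added chip lies at the origin of this cycle, so the class required for
        an empty block is off by \<open>a (Suc i)\<close> from the one in \<open>hit\<close>; by
        \<open>not_period_a\<close> both cannot hold.\<close>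
      moreover have "wsum (\<theta> (Suc i)) D + a (Suc i) * of_int k + a (Suc i) * of_int (int i - int j - ?x)
          = (wsum (\<theta> (Suc i)) D - a (Suc i) * of_int (?x - int (Suc i) + 1)) - a (Suc i)"
        by (simp add: k algebra_simps)
      then have "\<not> period (Suc i) (wsum (\<theta> (Suc i)) D + a (Suc i) * of_int k
          + a (Suc i) * of_int (int i - int j - ?x))"
        using blocked(1) not_period_a[OF S] unfolding hit_def
        by (metis diff_diff_eq2 diff_add_cancel add_diff_cancel_left' period_diff)
      ultimately have "int i - int j - ?x < degree_upto (Suc i) F" by (rule *[OF F(2)])
      with blocked show ?thesis by simp
    qed
    moreover have "divisor_on \<Gamma> ?E"
      using E S by (intro divisor_on_add divisor_on_single) (simp_all add: forces_def points_\<Gamma>)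
    moreover have "effective ?E"
      using E by (intro effective_add effective_single) (simp_all add: forces_def)
    moreover have "divisor_degree ?E = int j"
      using E by (simp add: forces_def k divisor_degree_wsum wsum_add)
    moreover have "wsum (\<theta> i') ?E = - a i' * of_int j" if "i' \<in> {1..g}" "Suc i < i'" for i'
      unfolding \<theta>E using E that by (auto simp: forces_def k algebra_simps)
    ultimately have "forces D (Suc i) j ?E" unfolding forces_def by blast
    then show ?thesis by blast
  next
    case move
    obtain E where E: "forces D i j E" using Suc by fastforce
    have "int (Suc i) - int j - pos D (Suc i) j \<le> degree_upto (Suc i) F"
      if F: "divisor_on \<Gamma> F" "effective F"
        and per: "\<forall>i'\<in>{1..Suc i}. period i' (wsum (\<theta> i') D - wsum (\<theta> i') E - wsum (\<theta> i') F)" for F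
    proof -
      have "int i - int j - ?x \<le> degree_upto i F"
        using E F per by (auto simp: forces_def)
      with move degree_upto_mono[OF F(2), of i "Suc i"] show ?thesis by auto
    qed
    then have "forces D (Suc i) j E" using E by (auto simp: forces_def)
    then show ?thesis by blast
  qed
qed

text \<open>At the end of the chain the residual divisor \<open>D' - E\<close> has only the degree
  of \<open>D\<close> minus \<open>r\<close> chips, so the particle \<open>r\<close> must have
  travelled far enough.\<close>

lemma rank_pos:
  assumes D: "divisor_on \<Gamma> D" and r: "rank_at_least D r"
  shows "int g - divisor_degree D \<le> pos D g r"
proof -
  obtain E where E: "forces D g r E" using forces_exists by blast
  then obtain D' where D': "divisor_on \<Gamma> D'" "linearly_equivalent \<Gamma> D D'" "effective (D' - E)"
    using r unfolding rank_at_least_def forces_def by blast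
  let ?F = "D' - E"
  have onF: "divisor_on \<Gamma> ?F" using D'(1) E by (auto simp: forces_def intro: divisor_on_diff)
  have "\<forall>i\<in>{1..g}. period i (wsum (\<theta> i) D - wsum (\<theta> i) E - wsum (\<theta> i) ?F)"
    using D'(2) linearly_equivalent_iff[OF D D'(1)] by (simp add: wsum_diff)
  then have "int g - int r - pos D g r \<le> degree_upto g ?F"
    using E onF D'(3) unfolding forces_def by blast
  also have "degree_upto g ?F = divisor_degree D - int r"
    using E D'(2) linearly_equivalent_iff[OF D D'(1)]
    by (simp add: degree_upto_all[OF onF]) (simp add: forces_def divisor_degree_wsum wsum_diff)
  finally show ?thesis by simp
qed

lemma rank_le_degree: "divisor_on \<Gamma> D \<Longrightarrow> rank_at_least D r \<Longrightarrow> int r \<le> divisor_degree D"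
  using rank_pos[of D r] pos_le[of D g r] by simp

lemma rank_tableau:
  assumes D: "divisor_on \<Gamma> D" and r: "rank_at_least D r"
    and q: "int q \<le> int g - divisor_degree D + int r"
  shows "\<exists>t. displacement_tableau torsion g (Suc r) q t"
proof -
  \<comment> \<open>\<open>t j c\<close> is the cycle on which particle \<open>j\<close> makes move
    number c + 1, leaving position c - j, the content of the cell. A particle makes its moves one
    after another and must wait for the particle in front, which orders rows and columns; equal
    entries are hits on the same cycle.\<close>
  define t where "t j c = (LEAST i. int c - int j < pos D i j)" for j c
  have step: "t j c \<le> g" "1 \<le> t j c" "hit D (t j c) (int c - int j)"
      "\<And>j'. j = Suc j' \<Longrightarrow> int c - int j' \<le> pos D (t j c - 1) j' - 1"
      "pos D (t j c - 1) j = int c - int j"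
    if j: "j < Suc r" and c: "c < q" for j c
  proof -
    let ?P = "\<lambda>i. int c - int j < pos D i j"
    have Pg: "?P g" using rank_pos[OF D r] pos_descend[of j r D g] q j c by auto
    then have P: "?P (t j c)" unfolding t_def by (rule LeastI)
    show "t j c \<le> g" unfolding t_def using Pg by (rule Least_le)
    show "1 \<le> t j c" using P by (cases "t j c") auto
    then obtain i where i: "t j c = Suc i" by (cases "t j c") auto
    have nP: "\<not> ?P i" using not_less_Least[of i ?P] i by (simp add: t_def[symmetric])
    have moved: "hit D (Suc i) (pos D i j) \<and> (j = 0 \<or> pos D i j + 1 < pos D i (j - 1))"
    proof (rule ccontr)
      assume no: "\<not> ?thesis"
      have "pos D (Suc i) j = pos D i j" by (simp only: pos.simps no of_bool_eq add_0_right)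
      from P[unfolded i this] nP show False by blast
    qed
    have "pos D (Suc i) j \<le> pos D i j + 1" by (simp add: of_bool_def)
    with P[unfolded i] nP have "pos D i j = int c - int j" by linarith
    with moved show "hit D (t j c) (int c - int j)"
        "\<And>j'. j = Suc j' \<Longrightarrow> int c - int j' \<le> pos D (t j c - 1) j' - 1"
        "pos D (t j c - 1) j = int c - int j"
      unfolding i by auto
  qed
  have le: "t j c \<le> i" if "int c - int j < pos D i j" for i j c
    unfolding t_def using that by (rule Least_le)
  have "displacement_tableau torsion g (Suc r) q t"
    unfolding displacement_tableau_def
  proof (intro conjI allI impI)
    fix x y assume "x < Suc r" "y < q"
    then show "1 \<le> t x y" "t x y \<le> g" using step by auto
  next
    fix x y assume xy: "Suc x < Suc r" "y < q"
    then have "t x y \<le> t (Suc x) y - 1"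
      using step(4)[of "Suc x" y x] by (intro le) auto
    with step(2)[OF xy] show "t x y < t (Suc x) y" by simp
  next
    fix x y assume xy: "x < Suc r" "Suc y < q"
    then have "t x y \<le> t x (Suc y) - 1"
      using step(5)[of x "Suc y"] by (intro le) auto
    with step(2)[OF xy] show "t x y < t x (Suc y)" by simp
  next
    fix x y x' y'
    assume A: "x < Suc r" "y < q" "x' < Suc r" "y' < q" and eq: "t x y = t x' y'"
    have "period (t x y) ((wsum (\<theta> (t x y)) D - a (t x y) * of_int (int y' - int x' - int (t x y) + 1))
       - (wsum (\<theta> (t x y)) D - a (t x y) * of_int (int y - int x - int (t x y) + 1)))"
      using step(3)[OF A(3,4)] step(3)[OF A(1,2)] unfolding eq[symmetric] hit_def by (rule period_diff)
    also have "(wsum (\<theta> (t x y)) D - a (t x y) * of_int (int y' - int x' - int (t x y) + 1))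
       - (wsum (\<theta> (t x y)) D - a (t x y) * of_int (int y - int x - int (t x y) + 1))
       = a (t x y) * of_int (int y - int x - (int y' - int x'))"
      by (simp add: algebra_simps)
    finally show "torsion (t x y) (int y - int x - (int y' - int x'))" by (simp add: torsion_def)
  qed
  then show ?thesis by blast
qed


section \<open>From tableaux to divisors\<close>

text \<open>The number \<open>x\<close> is reduced to the fundamental domain from -
  \<open>a i\<close> to \<open>b i\<close>, which runs along the upper arc to \<open>W i\<close> and
  back along the lower one.\<close>

lemma point_exists:
  assumes i: "i \<in> {1..g}"
  shows "\<exists>p\<in>points \<Gamma>. block p = i \<and> period i (\<theta> i p - x)"
proof -
  let ?L = "a i + b i"
  have L: "0 < ?L" using a_pos[OF i] b_pos[OF i] by simp
  define k where "k = \<lfloor>(x + a i) / ?L\<rfloor>"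
  define r where "r = x - of_int k * ?L"
  have "of_int k \<le> (x + a i) / ?L" "(x + a i) / ?L < of_int k + 1"
    unfolding k_def by linarith+
  then have r: "- a i \<le> r" "r < b i"
    using L by (simp_all add: r_def field_simps)
  have "period i (r - x)"
    unfolding period_def by (rule exI[of _ "- k"]) (simp add: r_def)
  moreover have "\<exists>p\<in>points \<Gamma>. block p = i \<and> coordinate p = r"
  proof -
    consider "r = - a i" | "- a i < r" "r < 0" | "r = 0" | "0 < r" using r by linarith
    then show ?thesis
    proof cases
      case 1
      then show ?thesis using i by (intro bexI[of _ "Vertex (V i)"]) (auto simp: points_\<Gamma>)
    next
      case 2
      then show ?thesis using i
        by (intro bexI[of _ "Inner (Upper i) (r + a i)"]) (auto simp: points_\<Gamma> arc_simps len_\<Gamma>)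
    next
      case 3
      then show ?thesis using i by (intro bexI[of _ "Vertex (W i)"]) (auto simp: points_\<Gamma>)
    next
      case 4
      then show ?thesis using i r
        by (intro bexI[of _ "Inner (Lower i) (b i - r)"]) (auto simp: points_\<Gamma> arc_simps len_\<Gamma>)
    qed
  qed
  ultimately show ?thesis by (auto simp: \<theta>_def)
qed

lemma sum_split_at:
  fixes h :: "nat \<Rightarrow> 'r::comm_monoid_add"
  assumes "i \<in> {1..g}" "\<And>j. j \<in> {i<..g} \<Longrightarrow> h j = 0"
  shows "(\<Sum>j=1..g. h j) = (\<Sum>j=1..<i. h j) + h i"
proof -
  have "{1..g} = {1..<i} \<union> ({i} \<union> {i<..g})" using assms(1) by auto
  then have "(\<Sum>j=1..g. h j) = sum h ({1..<i} \<union> ({i} \<union> {i<..g}))" by simp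
  also have "\<dots> = (\<Sum>j=1..<i. h j) + (h i + (\<Sum>j\<in>{i<..g}. h j))"
    by (subst sum.union_disjoint; auto)+
  finally show ?thesis using assms(2) by simp
qed

text \<open>
  Several chips on one cycle realise any prescribed class, and so does the empty divisor if the
  class is the one determined by the chips on the preceding cycles.
\<close>

lemma effective_exists:
  fixes \<epsilon> :: "nat \<Rightarrow> nat" and x :: "nat \<Rightarrow> real"
  assumes x: "\<And>i. i \<in> {1..g} \<Longrightarrow> \<epsilon> i = 0 \<Longrightarrow> period i (x i + a i * (\<Sum>j=1..<i. real (\<epsilon> j)))"
  shows "\<exists>F. divisor_on \<Gamma> F \<and> effective F \<and> divisor_degree F = (\<Sum>i=1..g. int (\<epsilon> i)) \<and>
    (\<forall>i\<in>{1..g}. period i (wsum (\<theta> i) F - x i))"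
proof -
  have "\<forall>i\<in>{1..g}. \<exists>p. p \<in> points \<Gamma> \<and> block p = i \<and>
      period i (\<theta> i p - (x i + a i * (\<Sum>j=1..<i. real (\<epsilon> j))))"
    using point_exists by blast
  then obtain p where p: "\<And>i. i \<in> {1..g} \<Longrightarrow> p i \<in> points \<Gamma>" "\<And>i. i \<in> {1..g} \<Longrightarrow> block (p i) = i"
      "\<And>i. i \<in> {1..g} \<Longrightarrow> period i (\<theta> i (p i) - (x i + a i * (\<Sum>j=1..<i. real (\<epsilon> j))))"
    by metis
  \<comment> \<open>One free chip adjusts the class on an occupied block; the others wait at
    \<open>W i\<close>, where the coordinate is 0.\<close>
  define G where "G i = (if \<epsilon> i = 0 then 0
      else Poly_Mapping.single (p i) 1 + Poly_Mapping.single (Vertex (W i)) (int (\<epsilon> i) - 1))" for i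
  define F where "F = (\<Sum>i=1..g. G i)"
  have "divisor_on \<Gamma> F"
    unfolding F_def G_def using p(1)
    by (auto intro!: divisor_on_sum divisor_on_add divisor_on_single divisor_on_0 simp: points_\<Gamma>)
  moreover have "effective F"
    unfolding F_def G_def by (auto intro!: effective_sum effective_add effective_single effective_0)
  moreover have "divisor_degree F = (\<Sum>i=1..g. int (\<epsilon> i))"
    unfolding F_def divisor_degree_wsum wsum_sum by (intro sum.cong) (auto simp: G_def wsum_add)
  moreover have "period i (wsum (\<theta> i) F - x i)" if i: "i \<in> {1..g}" for i
  proof -
    have "wsum (\<theta> i) F = (\<Sum>j=1..<i. wsum (\<theta> i) (G j)) + wsum (\<theta> i) (G i)"
      unfolding F_def wsum_sum
      by (rule sum_split_at[OF i]) (use i p(2) in \<open>auto simp: G_def wsum_add \<theta>_def\<close>)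
    also have "(\<Sum>j=1..<i. wsum (\<theta> i) (G j)) = (\<Sum>j=1..<i. - a i * real (\<epsilon> j))"
      using i p(2) by (intro sum.cong) (auto simp: G_def wsum_add \<theta>_def algebra_simps)
    also have "\<dots> = - a i * (\<Sum>j=1..<i. real (\<epsilon> j))"
      by (simp add: sum_distrib_left)
    finally have F: "wsum (\<theta> i) F = - a i * (\<Sum>j=1..<i. real (\<epsilon> j)) + wsum (\<theta> i) (G i)" .
    show ?thesis
    proof (cases "\<epsilon> i = 0")
      case True
      then have "wsum (\<theta> i) F - x i = - (x i + a i * (\<Sum>j=1..<i. real (\<epsilon> j)))"
        by (simp add: F G_def)
      then show ?thesis using period_uminus[OF x[OF i True]] by (simp only:)
    next
      case False
      have "\<theta> i (Vertex (W i)) = 0" by (simp add: \<theta>_def)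
      with False have "wsum (\<theta> i) F - x i = \<theta> i (p i) - (x i + a i * (\<Sum>j=1..<i. real (\<epsilon> j)))"
        by (simp add: F G_def wsum_add)
      then show ?thesis using p(3)[OF i] by (simp only:)
    qed
  qed
  ultimately show ?thesis by blast
qed

lemma effective_degree_1:
  assumes "effective E" "divisor_degree E = 1"
  shows "\<exists>p. E = Poly_Mapping.single p 1"
proof -
  have ge: "1 \<le> Poly_Mapping.lookup E p" if "p \<in> Poly_Mapping.keys E" for p
  proof -
    have "0 \<le> Poly_Mapping.lookup E p" "Poly_Mapping.lookup E p \<noteq> 0"
      using assms(1) that by (simp_all add: effective_def in_keys_iff)
    then show ?thesis by simp
  qed
  have "Poly_Mapping.keys E \<noteq> {}" using assms(2) by (auto simp: divisor_degree_def)
  then obtain p where p: "p \<in> Poly_Mapping.keys E" by blast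
  have deg: "Poly_Mapping.lookup E p + (\<Sum>p\<in>Poly_Mapping.keys E - {p}. Poly_Mapping.lookup E p) = 1"
    using assms(2) p by (simp add: divisor_degree_def sum.remove[symmetric])
  have "int (card (Poly_Mapping.keys E - {p})) \<le> (\<Sum>p\<in>Poly_Mapping.keys E - {p}. Poly_Mapping.lookup E p)"
    using sum_mono[of "Poly_Mapping.keys E - {p}" "\<lambda>_. 1" "Poly_Mapping.lookup E"] ge by simp
  with deg ge[OF p] have "card (Poly_Mapping.keys E - {p}) = 0" "Poly_Mapping.lookup E p = 1"
    by linarith+
  moreover from this(1) have "Poly_Mapping.keys E \<subseteq> {p}"
    by (metis Diff_eq_empty_iff card_0_eq finite_Diff finite_keys)
  ultimately have "Poly_Mapping.lookup E q = (if q = p then 1 else 0)" for q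
    by (auto simp: in_keys_iff)
  then have "E = Poly_Mapping.single p 1"
    by (intro poly_mapping_eqI) (simp add: lookup_single when_def)
  then show ?thesis by blast
qed

text \<open>When a point of block k is subtracted, the residual divisor may leave empty the cycles
  before k listed in row 0 and those after k listed in row 1. A cycle listed in both rows makes two
  demands on the class of the divisor, and the torsion condition makes them agree.\<close>

lemma tableau_rank_1:
  assumes t: "displacement_tableau torsion g 2 n t"
  shows "\<exists>D. divisor_on \<Gamma> D \<and> divisor_degree D = int g - int n + 1 \<and> rank_at_least D 1"
proof -
  have range: "1 \<le> t x c" "t x c \<le> g" if "x < 2" "c < n" for x c
    using t that by (auto simp: displacement_tableau_def)
  have col: "t 0 c < t 1 c" if "c < n" for c
    using t that by (auto simp: displacement_tableau_def)
  have row: "t x c < t x c'" if "x < 2" "c < c'" "c' < n" for x c c'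
    using that(2,3)
  proof (induction c')
    case (Suc c')
    then have "t x c' < t x (Suc c')"
      using t that(1) by (auto simp: displacement_tableau_def)
    with Suc show ?case by (cases "c = c'") (auto intro: less_trans)
  qed simp
  define m where "m x i = card {c. c < n \<and> t x c \<le> i}" for x i
  have fin: "finite {c. c < n \<and> P c}" for P by simp
  have m_at: "m x i = c" if "x < 2" "c < n" "t x c = Suc i" for x i c
  proof -
    have "{c'. c' < n \<and> t x c' \<le> i} = {..<c}"
    proof (intro set_eqI iffI)
      fix c' assume "c' \<in> {c'. c' < n \<and> t x c' \<le> i}"
      with row[OF that(1), of c c'] that show "c' \<in> {..<c}" by (cases c c' rule: linorder_cases) auto
    next
      fix c' assume "c' \<in> {..<c}"
      with row[OF that(1), of c' c] that show "c' \<in> {c'. c' < n \<and> t x c' \<le> i}" by auto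
    qed
    then show ?thesis by (simp add: m_def)
  qed
  have m_Suc: "m x (Suc i) = m x i + of_bool (\<exists>c<n. t x c = Suc i)" if x: "x < 2" for x i
  proof (cases "\<exists>c<n. t x c = Suc i")
    case True
    then obtain c where c: "c < n" "t x c = Suc i" by blast
    have "{c'. c' < n \<and> t x c' \<le> Suc i} = insert c {c'. c' < n \<and> t x c' \<le> i}"
    proof (intro set_eqI iffI)
      fix c' assume "c' \<in> {c'. c' < n \<and> t x c' \<le> Suc i}"
      with row[OF x, of c c'] row[OF x, of c' c] c
      show "c' \<in> insert c {c'. c' < n \<and> t x c' \<le> i}" by (cases c c' rule: linorder_cases) auto
    qed (use c in auto)
    then have "m x (Suc i) = Suc (m x i)" using c by (simp add: m_def)
    with True show ?thesis by simp
  next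
    case False
    then have "{c'. c' < n \<and> t x c' \<le> Suc i} = {c'. c' < n \<and> t x c' \<le> i}"
      by (auto simp: le_Suc_eq)
    with False show ?thesis by (simp add: m_def)
  qed
  have m_0: "m x 0 = 0" if "x < 2" for x
    using range(1)[OF that] by (force simp: m_def)
  have m_g: "m x g = n" if "x < 2" for x
  proof -
    have "{c. c < n \<and> t x c \<le> g} = {..<n}" using range(2)[OF that] by auto
    then show ?thesis by (simp add: m_def)
  qed
  \<comment> \<open>From strict columns. It ensures that block k, where the count switches from row
    0 to row 1, gets at least one chip and so can realise any class.\<close>
  have m_col: "m 1 (Suc i) \<le> m 0 i" for i
    unfolding m_def
  proof (intro card_mono subsetI)
    fix c assume "c \<in> {c. c < n \<and> t 1 c \<le> Suc i}"
    with col[of c] show "c \<in> {c. c < n \<and> t 0 c \<le> i}" by simp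
  qed simp
  \<comment> \<open>Before \<open>P\<close>, a cycle i of row 0 in column c sees
    \<open>i - 1 - c\<close> residual chips on its left, giving \<open>a i\<close> * (c - i + 1).
    After \<open>P\<close>, with row 1 instead, \<open>P\<close> itself counts as one more chip,
    giving \<open>a i\<close> * (c - i).\<close>
  define tgt where "tgt i = (if \<exists>c<n. t 0 c = i then a i * (real (m 0 (i - 1)) - real i + 1)
      else a i * (real (m 1 (i - 1)) - real i))" for i
  have tgt0: "period i (tgt i - a i * (real c - real i + 1))" if "c < n" "t 0 c = i" for i c
    using that range(1)[of 0 c] m_at[of 0 c "i - 1"] by (auto simp: tgt_def)
  have tgt1: "period i (tgt i - a i * (real c - real i))" if c: "c < n" "t 1 c = i" for i c
  proof (cases "\<exists>c'<n. t 0 c' = i")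
    case True
    then obtain c' where c': "c' < n" "t 0 c' = i" by blast
    have "torsion (t 0 c') ((int c' - int 0) - (int c - int 1))"
      using t c c' unfolding displacement_tableau_def by (metis one_less_numeral_iff semiring_norm(76) zero_less_numeral)
    then have "period i (a i * (real c' - real c + 1))"
      by (simp add: torsion_def c' algebra_simps)
    from period_add[OF tgt0[OF c'] this] show ?thesis by (simp add: algebra_simps)
  next
    case False
    with c range(1)[of 1 c] m_at[of 1 c "i - 1"] show ?thesis by (auto simp: tgt_def)
  qed
  obtain D0 where D0: "divisor_on \<Gamma> D0" "divisor_degree D0 = int g"
      "\<And>i. i \<in> {1..g} \<Longrightarrow> period i (wsum (\<theta> i) D0 - tgt i)"
    using effective_exists[of "\<lambda>_. 1" tgt] by auto
  \<comment> \<open>\<open>W g\<close> has coordinate 0 on every cycle, so chips there correct the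
    degree without changing any class.\<close>
  define D where "D = D0 + Poly_Mapping.single (Vertex (W g)) (1 - int n)"
  have D: "divisor_on \<Gamma> D"
    unfolding D_def using D0(1) g_pos by (intro divisor_on_add divisor_on_single) (auto simp: points_\<Gamma>)
  have deg: "divisor_degree D = int g - int n + 1"
    using D0(2) by (simp add: D_def divisor_degree_wsum wsum_add)
  have per: "period i (wsum (\<theta> i) D - tgt i)" if i: "i \<in> {1..g}" for i
  proof -
    have "\<theta> i (Vertex (W g)) = 0" using i by (simp add: \<theta>_def)
    then show ?thesis using D0(3)[OF i] by (simp add: D_def wsum_add)
  qed
  have "\<exists>F. divisor_on \<Gamma> F \<and> effective F \<and> divisor_degree F = int g - int n \<and>
      (\<forall>i\<in>{1..g}. period i (wsum (\<theta> i) F - (wsum (\<theta> i) D - \<theta> i P)))"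
    if P: "P \<in> points \<Gamma>" for P
  proof -
    define k where "k = block P"
    have k: "k \<in> {1..g}" using block_points[OF P] by (simp add: k_def)
    define \<epsilon> :: "nat \<Rightarrow> nat" where "\<epsilon> i =
        (if i < k then of_bool (\<nexists>c. c < n \<and> t 0 c = i)
         else if i = k then m 0 (k - 1) + 1 - m 1 k
         else of_bool (\<nexists>c. c < n \<and> t 1 c = i))" for i
    have m_k: "m 1 k \<le> m 0 (k - 1)" using m_col[of "k - 1"] k by simp
    have sum: "(\<Sum>j=1..i. int (\<epsilon> j)) = int i - int (if i < k then m 0 i else m 1 i)" for i
    proof (induction i)
      case 0
      then show ?case using k m_0 by simp
    next
      case (Suc i)
      consider "Suc i < k" | "Suc i = k" | "k < Suc i" by linarith
      then show ?case
      proof cases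
        case 1
        then show ?thesis using Suc m_Suc[of 0 i] by (auto simp: \<epsilon>_def)
      next
        case 2
        then show ?thesis using Suc m_k by (auto simp: \<epsilon>_def of_nat_diff)
      next
        case 3
        then show ?thesis using Suc m_Suc[of 1 i] by (auto simp: \<epsilon>_def)
      qed
    qed
    have sum': "(\<Sum>j=1..<i. real (\<epsilon> j)) = real i - 1 - real (if i \<le> k then m 0 (i - 1) else m 1 (i - 1))"
      if i: "i \<in> {1..g}" for i
    proof -
      have "{1..<i} = {1..i - 1}" using i by auto
      then have "(\<Sum>j=1..<i. real (\<epsilon> j)) = of_int (\<Sum>j=1..i - 1. int (\<epsilon> j))" by simp
      then show ?thesis unfolding sum using i by (auto simp: of_nat_diff)
    qed
    have "period i (wsum (\<theta> i) D - \<theta> i P + a i * (\<Sum>j=1..<i. real (\<epsilon> j)))"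
      if i: "i \<in> {1..g}" and \<epsilon>: "\<epsilon> i = 0" for i
    proof -
      consider "i < k" | "i = k" | "k < i" by linarith
      then show ?thesis
      proof cases
        case 1
        then obtain c where c: "c < n" "t 0 c = i" using \<epsilon> by (auto simp: \<epsilon>_def split: if_splits)
        have "m 0 (i - 1) = c" using m_at[of 0 c "i - 1"] c i by simp
        then have eq: "wsum (\<theta> i) D - \<theta> i P + a i * (\<Sum>j=1..<i. real (\<epsilon> j)) =
            (wsum (\<theta> i) D - tgt i) + (tgt i - a i * (real c - real i + 1))"
          unfolding sum'[OF i] using 1 by (simp add: \<theta>_def k_def[symmetric] algebra_simps)
        show ?thesis unfolding eq by (intro period_add per i tgt0 c)
      next
        case 2
        with \<epsilon> m_k show ?thesis by (simp add: \<epsilon>_def)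
      next
        case 3
        then obtain c where c: "c < n" "t 1 c = i" using \<epsilon> by (auto simp: \<epsilon>_def split: if_splits)
        have "m 1 (i - 1) = c" using m_at[of 1 c "i - 1"] c i by simp
        then have eq: "wsum (\<theta> i) D - \<theta> i P + a i * (\<Sum>j=1..<i. real (\<epsilon> j)) =
            (wsum (\<theta> i) D - tgt i) + (tgt i - a i * (real c - real i))"
          unfolding sum'[OF i] using 3 by (simp add: \<theta>_def k_def[symmetric] algebra_simps)
        show ?thesis unfolding eq by (intro period_add per i tgt1 c)
      qed
    qed
    from effective_exists[of \<epsilon> "\<lambda>i. wsum (\<theta> i) D - \<theta> i P", OF this]
    show ?thesis using sum[of g] m_g[of 1] k by auto
  qed
  note residual = this
  have "rank_at_least D 1"
    unfolding rank_at_least_def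
  proof (intro allI impI)
    fix E assume E: "divisor_on \<Gamma> E \<and> effective E \<and> divisor_degree E = int 1"
    then obtain P where P: "E = Poly_Mapping.single P 1" using effective_degree_1[of E] by auto
    with E have "P \<in> points \<Gamma>" by (simp add: divisor_on_def)
    from residual[OF this] obtain F where F: "divisor_on \<Gamma> F" "effective F" "divisor_degree F = int g - int n"
        "\<And>i. i \<in> {1..g} \<Longrightarrow> period i (wsum (\<theta> i) F - (wsum (\<theta> i) D - \<theta> i P))"
      by blast
    have on: "divisor_on \<Gamma> (F + E)" using F(1) E by (auto intro: divisor_on_add)
    have "period i (wsum (\<theta> i) D - wsum (\<theta> i) (F + E))" if "i \<in> {1..g}" for i
      using period_uminus[OF F(4)[OF that]] by (simp add: wsum_add P algebra_simps)
    moreover have "divisor_degree D = divisor_degree (F + E)"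
      using deg F(3) E by (simp add: divisor_degree_wsum wsum_add)
    ultimately have "linearly_equivalent \<Gamma> D (F + E)"
      using linearly_equivalent_iff[OF D on] by blast
    then show "\<exists>D'. divisor_on \<Gamma> D' \<and> effective D' \<and> linearly_equivalent \<Gamma> D D' \<and> effective (D' - E)"
      using on F(2) E by (intro exI[of _ "F + E"]) (auto intro: effective_add)
  qed
  with D deg show ?thesis by blast
qed


section \<open>Gonality and Clifford index\<close>

text \<open>The \<open>GREATEST\<close> is attained: 0 qualifies, as 0 is the only effective divisor
  of degree 0, and \<open>rank_le_degree\<close> bounds all candidates.\<close>

lemma divisor_rank_ge_1_imp:
  assumes D: "divisor_on \<Gamma> D" and "1 \<le> divisor_rank \<Gamma> D"
  shows "\<exists>r\<ge>1. divisor_rank \<Gamma> D = int r \<and> rank_at_least D r"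
proof -
  have ex: "\<exists>D'. divisor_on \<Gamma> D' \<and> effective D' \<and> linearly_equivalent \<Gamma> D D'"
    using assms(2) by (auto simp: divisor_rank_def split: if_splits)
  then have rank: "divisor_rank \<Gamma> D = int (GREATEST n. rank_at_least D n)"
    by (simp add: divisor_rank_def rank_at_least_def)
  have zero: "E = 0" if "effective E" "divisor_degree E = 0" for E :: "(chain_vertex, chain_arc) divisor"
  proof -
    have "\<forall>p\<in>Poly_Mapping.keys E. Poly_Mapping.lookup E p = 0"
      using that by (subst sum_nonneg_eq_0_iff[symmetric]) (auto simp: effective_def divisor_degree_def)
    then have "Poly_Mapping.lookup E p = 0" for p by (cases "p \<in> Poly_Mapping.keys E") (auto simp: in_keys_iff)
    then show "E = 0" by (intro poly_mapping_eqI) simp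
  qed
  have "rank_at_least D 0"
    unfolding rank_at_least_def using ex zero by fastforce
  moreover have "\<forall>n. rank_at_least D n \<longrightarrow> n \<le> nat (divisor_degree D)"
    using rank_le_degree[OF D] by fastforce
  ultimately have "rank_at_least D (GREATEST n. rank_at_least D n)"
    using GreatestI_nat by blast
  with rank assms(2) show ?thesis by auto
qed

lemma divisor_rank_ge_1I:
  assumes D: "divisor_on \<Gamma> D" and r: "rank_at_least D 1"
  shows "1 \<le> divisor_rank \<Gamma> D"
proof -
  let ?E = "Poly_Mapping.single (Vertex (V 1)) 1"
  have "divisor_on \<Gamma> ?E" "effective ?E" "divisor_degree ?E = int 1"
    using g_pos by (auto intro!: divisor_on_single effective_single simp: points_\<Gamma> divisor_degree_wsum)
  then have "\<exists>D'. divisor_on \<Gamma> D' \<and> effective D' \<and> linearly_equivalent \<Gamma> D D'"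
    using r unfolding rank_at_least_def by blast
  then have rank: "divisor_rank \<Gamma> D = int (GREATEST n. rank_at_least D n)"
    by (simp add: divisor_rank_def rank_at_least_def)
  have "\<forall>n. rank_at_least D n \<longrightarrow> n \<le> nat (divisor_degree D)"
    using rank_le_degree[OF D] by fastforce
  then have "1 \<le> (GREATEST n. rank_at_least D n)"
    using r Greatest_le_nat by blast
  with rank show ?thesis by simp
qed

text \<open>On the integers \<open>LEAST\<close> is attained only with a lower bound, which reduces
  it to the natural numbers.\<close>

lemma int_Least:
  fixes P :: "int \<Rightarrow> bool"
  assumes "P m" "\<And>k. P k \<Longrightarrow> c \<le> k"
  shows "P (LEAST k. P k)" and "P k \<Longrightarrow> (LEAST k. P k) \<le> k"
proof -
  define n where "n = (LEAST n. P (c + int n))"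
  have ex: "P (c + int (nat (k - c)))" if "P k" for k using that assms(2)[OF that] by simp
  have n: "P (c + int n)" unfolding n_def using ex[OF assms(1)] by (rule LeastI)
  have least: "c + int n \<le> k" if "P k" for k
    using Least_le[of "\<lambda>n. P (c + int n)", OF ex[OF that]] assms(2)[OF that] by (simp add: n_def)
  have "(LEAST k. P k) = c + int n" using n least by (rule Least_equality)
  with n least show "P (LEAST k. P k)" "P k \<Longrightarrow> (LEAST k. P k) \<le> k" by auto
qed

section \<open>Comparison of the two invariants\<close>

definition gonal :: "int \<Rightarrow> bool" where
  "gonal m \<longleftrightarrow> (\<exists>D. divisor_on \<Gamma> D \<and> divisor_degree D = m \<and> divisor_rank \<Gamma> D \<ge> 1)"

lemma gonal_ge_1: "gonal m \<Longrightarrow> 1 \<le> m"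
  using divisor_rank_ge_1_imp rank_le_degree unfolding gonal_def by fastforce

lemma gonal_tableau: "displacement_tableau torsion g 2 n t \<Longrightarrow> gonal (int g - int n + 1)"
  using tableau_rank_1 divisor_rank_ge_1I unfolding gonal_def by metis

lemma gonal_generic: "gonal (int g - int (g div 2) + 1)"
  using gonal_tableau trivial_two_row_tableau[of torsion] torsion_0 by blast

lemma gonality: "gonal (gonality \<Gamma>)" "gonal m \<Longrightarrow> gonality \<Gamma> \<le> m"
  using int_Least[of gonal, OF gonal_generic gonal_ge_1]
  by (simp_all add: gonality_def gonal_def[abs_def])

text \<open>Contributing means that the rectangle has at least two rows and two columns. The second
  bound shows that once some divisor contributes, so does one that computes the gonality.\<close>

lemma gonality_le_clifford_index_divisor:
  assumes "contributes_to_clifford_index \<Gamma> D"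
  shows "gonality \<Gamma> \<le> clifford_index_divisor \<Gamma> D + 2" and "gonality \<Gamma> \<le> int g - 1"
proof -
  have genus: "genus \<Gamma> = int g" using genus_chain_of_cycles[OF g_pos] .
  have D: "divisor_on \<Gamma> D" using assms by (simp add: contributes_to_clifford_index_def)
  obtain r where r: "1 \<le> r" "divisor_rank \<Gamma> D = int r" "rank_at_least D r"
    using divisor_rank_ge_1_imp[OF D] assms by (auto simp: contributes_to_clifford_index_def)
  let ?d = "divisor_degree D"
  define q where "q = nat (int g - ?d + int r)"
  have q: "int q = int g - ?d + int r" "2 \<le> q"
    using assms r(2) genus by (auto simp: contributes_to_clifford_index_def q_def)
  obtain t where t: "displacement_tableau torsion g (Suc r) q t"
    using rank_tableau[OF D r(3), of q] q(1) by auto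
  obtain t' where "displacement_tableau torsion g 2 (Suc r + q - 2) t'"
    using two_row_tableau_exists[OF t torsion_uminus, of "Suc r + q - 2"] q r(1) torsion_0 by auto
  from gonality(2)[OF gonal_tableau[OF this]]
  have *: "gonality \<Gamma> \<le> int g - int (Suc r + q - 2) + 1" .
  have "int (Suc r + q - 2) = int r + int q - 1" using q r(1) by linarith
  with * have "gonality \<Gamma> \<le> int g - int r - int q + 2" by simp
  with q r show "gonality \<Gamma> \<le> clifford_index_divisor \<Gamma> D + 2" "gonality \<Gamma> \<le> int g - 1"
    by (auto simp: clifford_index_divisor_def)
qed

lemma clifford_index_eq:
  assumes "3 \<le> g"
  shows "clifford_index \<Gamma> = gonality \<Gamma> - 2"
proof -
  have genus: "genus \<Gamma> = int g" using genus_chain_of_cycles[OF g_pos] .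
  obtain D where D: "divisor_on \<Gamma> D" "divisor_degree D = gonality \<Gamma>" "1 \<le> divisor_rank \<Gamma> D"
    using gonality(1) unfolding gonal_def by blast
  have contr: "contributes_to_clifford_index \<Gamma> D" if "gonality \<Gamma> \<le> int g - 1"
    using D that genus by (simp add: contributes_to_clifford_index_def)
  show ?thesis
  proof (cases "\<exists>D. contributes_to_clifford_index \<Gamma> D")
    case True
    then have cD: "contributes_to_clifford_index \<Gamma> D"
      using gonality_le_clifford_index_divisor(2) contr by blast
    have "clifford_index_divisor \<Gamma> D \<le> gonality \<Gamma> - 2"
      using D by (simp add: clifford_index_divisor_def)
    with gonality_le_clifford_index_divisor(1)[OF cD]
    have eq: "clifford_index_divisor \<Gamma> D = gonality \<Gamma> - 2" by simp
    have "(LEAST c. \<exists>D. contributes_to_clifford_index \<Gamma> D \<and> clifford_index_divisor \<Gamma> D = c) = gonality \<Gamma> - 2"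
    proof (rule Least_equality)
      show "\<exists>D. contributes_to_clifford_index \<Gamma> D \<and> clifford_index_divisor \<Gamma> D = gonality \<Gamma> - 2"
        using cD eq by blast
    next
      fix c assume "\<exists>D. contributes_to_clifford_index \<Gamma> D \<and> clifford_index_divisor \<Gamma> D = c"
      then show "gonality \<Gamma> - 2 \<le> c" using gonality_le_clifford_index_divisor(1) by fastforce
    qed
    with True show ?thesis by (simp add: clifford_index_def)
  next
    case False
    \<comment> \<open>The generic bound then leaves only genus 3 and gonality 3, where the
      conventional value (3 - 1) div 2 = 1 fits.\<close>
    with contr have "int g \<le> gonality \<Gamma>" by fastforce
    with gonality(2)[OF gonal_generic] have "gonality \<Gamma> = int g" "g = 3" using assms by linarith+
    moreover have "clifford_index \<Gamma> = (int g - 1) div 2"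
      using False by (simp add: clifford_index_def genus)
    ultimately show ?thesis by simp
  qed
qed

end

theorem theorem1:
  fixes g :: nat and a b l :: "nat \<Rightarrow> real"
  assumes "g \<ge> 3"
    and "\<And>i. i \<in> {1..g} \<Longrightarrow> a i > 0"
    and "\<And>i. i \<in> {1..g} \<Longrightarrow> b i > 0"
    and "\<And>i. i \<in> {1..<g} \<Longrightarrow> l i > 0"
  shows "clifford_index (chain_of_cycles g a b l) = gonality (chain_of_cycles g a b l) - 2"
proof -
  interpret chain g a b l
    by unfold_locales (use assms in auto)
  show ?thesis using assms(1) by (rule clifford_index_eq)
qed

end
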